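(* Let $\ell_1,\ldots,\ell_n$ be $n$ lines in $\mathbb{P}^2$ such that no three lines meet at a point. Let $P_{i,j}=\ell_i\cap\ell_j$ for $1\le i<j\le n$. Suppose that $Z$ is a set of double points and reduced points in $\mathbb{P}^2$ that satisfies the following conditions: (a) $\mathrm{Supp}(Z)\subseteq\bigcup_{i=1}^n\ell_i$. (b) If $2P$ is a double point of $Z$, then $P=P_{i,j}$ for some $i<j$. (c) If $Q$ is a reduced point of $Z$ and $Q\in\ell_i$, then $Q\ne\ell_i\cap\ell_p$ for all $p\ne i$. (d) Setting $Z_0=Z$, $Z_j=Z_{j-1}:\ell_j$ and $d_j=\deg(Z_{j-1}\cap\ell_j)$ for $j=1,\ldots,n$, one has $d_1>d_2>\cdots>d_n$. (e) There exist $i,j$ with $i<j$ such that $Z$ contains two reduced points $Q_1,Q_2\in\ell_i$ and a reduced point $R\in\ell_j$, but $2P_{i,j}$ is not a double point of $Z$. Let $Z'$ be the set of double and reduced points obtained by adding the double point $2P_{i,j}$ to $Z$ and removing the reduced points $\{R,Q_1,Q_2\}$ (with $i,j,Q_1,Q_2,R$ as in (e)). Then $Z$ and $Z'$ have the same Hilbert function.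
   Context: Let $k$ be an algebraically closed field of characteristic zero, $\mathbb{P}^2=\mathbb{P}^2_k$ and $R=k[x_0,x_1,x_2]$ with the standard grading (the letter $R$ in condition (e) denotes a point). For distinct points $P_1,\ldots,P_s\in\mathbb{P}^2$ with homogeneous ideals $I_{P_i}$ and positive integers $m_1,\ldots,m_s$, the set of fat points $Z=m_1P_1+\cdots+m_sP_s$ is the scheme defined by $I_Z=I_{P_1}^{m_1}\cap\cdots\cap I_{P_s}^{m_s}$. Its support is $\mathrm{Supp}(Z)=\{P_1,\ldots,P_s\}$; $m_i$ is the multiplicity of $P_i$. A point of multiplicity $2$ is a double point of $Z$ (also written $2P_i$), and a point of multiplicity $1$ is a reduced (simple) point of $Z$. A set of double points and reduced points is a $Z$ with all $m_i\in\{1,2\}$. The Hilbert function of $Z$ is $H_Z(i)=\dim_k(R/I_Z)_i$. For a fat point scheme $W$ and a line $\ell$ defined by a linear form $L$, $W:\ell$ is the scheme defined by the ideal $I_W:\langle L\rangle$; concretely, it is obtained from $W$ by lowering by one the multiplicity of each point of $\mathrm{Supp}(W)$ lying on $\ell$ (removing points whose multiplicity was $1$) and leaving the other multiplicities unchanged. $\deg(W\cap\ell)$ is the degree of the scheme-theoretic intersection, which equals the sum of the multiplicities in $W$ of the points of $\mathrm{Supp}(W)$ lying on $\ell$. *)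

theory Defs
  imports "HOL-Analysis.Analysis" "HOL-Library.Poly_Mapping"
    "HOL-Computational_Algebra.Polynomial" "HOL-Library.Multiset"
begin

section \<open>The projective plane\<close>

text \<open>Two nonzero vectors represent the same point iff they are proportional. The relation is
  partial: the zero vector represents no point.\<close>

definition proj_rel :: "'k::field ^ 3 \<Rightarrow> 'k ^ 3 \<Rightarrow> bool" where
  "proj_rel v w \<longleftrightarrow> v \<noteq> 0 \<and> w \<noteq> 0 \<and> (\<exists>c. c \<noteq> 0 \<and> w = c *s v)"

quotient_type (overloaded) 'k proj_plane = "'k::field ^ 3" / partial: proj_rel
proof (rule part_equivpI)
  have "proj_rel (1 :: 'k ^ 3) 1"
    unfolding proj_rel_def by (auto simp: vec_eq_iff intro!: exI[of _ 1])
  then show "\<exists>v :: 'k ^ 3. proj_rel v v" ..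
  show "symp (proj_rel :: 'k ^ 3 \<Rightarrow> _)"
  proof (rule sympI)
    fix v w :: "'k ^ 3" assume "proj_rel v w"
    then obtain c where "v \<noteq> 0" "w \<noteq> 0" "c \<noteq> 0" "w = c *s v"
      unfolding proj_rel_def by auto
    then show "proj_rel w v"
      unfolding proj_rel_def by (auto intro!: exI[of _ "inverse c"] simp: vec_eq_iff)
  qed
  show "transp (proj_rel :: 'k ^ 3 \<Rightarrow> _)"
  proof (rule transpI)
    fix u v w :: "'k ^ 3" assume "proj_rel u v" "proj_rel v w"
    then obtain c d where "u \<noteq> 0" "w \<noteq> 0" "c \<noteq> 0" "d \<noteq> 0" "w = d *s (c *s u)"
      unfolding proj_rel_def by auto
    then show "proj_rel u w"
      unfolding proj_rel_def by (auto intro!: exI[of _ "d * c"] simp: vec_eq_iff)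
  qed
qed

section \<open>The polynomial ring in three variables\<close>

text \<open>Monomials are exponent vectors indexed by the three-element type \<^typ>\<open>3\<close>.\<close>

type_synonym 'k poly3 = "(3 \<Rightarrow>\<^sub>0 nat) \<Rightarrow>\<^sub>0 'k"

definition poly3_eval :: "'k::field poly3 \<Rightarrow> 'k ^ 3 \<Rightarrow> 'k" where
  "poly3_eval f v = (\<Sum>m\<in>Poly_Mapping.keys f.
     Poly_Mapping.lookup f m * (\<Prod>i\<in>UNIV. (v $ i) ^ Poly_Mapping.lookup m i))"

text \<open>The graded piece of degree \<open>d\<close>; it contains 0.\<close>

definition forms :: "nat \<Rightarrow> 'k::field poly3 set" where
  "forms d = {f. \<forall>m\<in>Poly_Mapping.keys f. (\<Sum>i\<in>UNIV. Poly_Mapping.lookup m i) = d}"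

definition poly3_scale :: "'k::field \<Rightarrow> 'k poly3 \<Rightarrow> 'k poly3" where
  "poly3_scale c f = Poly_Mapping.single 0 c * f"

definition linear_form :: "'k::field poly3 \<Rightarrow> bool" where
  "linear_form L \<longleftrightarrow> L \<noteq> 0 \<and> L \<in> forms 1"

definition vanishes_at :: "'k::field poly3 \<Rightarrow> 'k proj_plane \<Rightarrow> bool" where
  "vanishes_at f P \<longleftrightarrow> (\<forall>v. v \<noteq> 0 \<and> abs_proj_plane v = P \<longrightarrow> poly3_eval f v = 0)"

definition zero_locus :: "'k::field poly3 \<Rightarrow> 'k proj_plane set" where
  "zero_locus f = {P. vanishes_at f P}"

section \<open>Ideals\<close>

lemma module_times: "module ((*) :: 'a::comm_ring_1 \<Rightarrow> 'a \<Rightarrow> 'a)"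
  by unfold_locales (simp_all add: algebra_simps)

text \<open>An ideal of a commutative ring is a submodule of the ring over itself.\<close>

definition ideal_gen :: "'a::comm_ring_1 set \<Rightarrow> 'a set" where
  "ideal_gen S = module.span (*) S"

definition ideal_sum :: "'a::comm_ring_1 set \<Rightarrow> 'a set \<Rightarrow> 'a set" where
  "ideal_sum I J = {f + g | f g. f \<in> I \<and> g \<in> J}"

definition ideal_mult :: "'a::comm_ring_1 set \<Rightarrow> 'a set \<Rightarrow> 'a set" where
  "ideal_mult I J = ideal_gen {f * g | f g. f \<in> I \<and> g \<in> J}"

primrec ideal_power :: "'a::comm_ring_1 set \<Rightarrow> nat \<Rightarrow> 'a set" where
  "ideal_power I 0 = UNIV"
| "ideal_power I (Suc m) = ideal_mult I (ideal_power I m)"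

definition ideal_colon :: "'a::comm_ring_1 set \<Rightarrow> 'a set \<Rightarrow> 'a set" where
  "ideal_colon I J = {f. \<forall>g\<in>J. f * g \<in> I}"

section \<open>Hilbert functions\<close>

text \<open>The dimension of \<open>V / (V \<inter> W)\<close>: the size of a finite set \<open>B \<subseteq> V\<close> of representatives of a basis
  of the quotient, i.e. such that every \<open>v \<in> V\<close> is congruent modulo \<open>W\<close> to exactly one linear
  combination of \<open>B\<close>.\<close>

definition quotient_basis ::
  "('k::field \<Rightarrow> 'v::ab_group_add \<Rightarrow> 'v) \<Rightarrow> 'v set \<Rightarrow> 'v set \<Rightarrow> 'v set \<Rightarrow> bool" where
  "quotient_basis smul V W B \<longleftrightarrow> finite B \<and> B \<subseteq> V \<and>
     (\<forall>v\<in>V. \<exists>!c. (\<forall>b. b \<notin> B \<longrightarrow> c b = 0) \<and> v - (\<Sum>b\<in>B. smul (c b) b) \<in> W)"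

definition quotient_dim :: "('k::field \<Rightarrow> 'v::ab_group_add \<Rightarrow> 'v) \<Rightarrow> 'v set \<Rightarrow> 'v set \<Rightarrow> nat" where
  "quotient_dim smul V W = (THE n. \<exists>B. quotient_basis smul V W B \<and> card B = n)"

text \<open>The Hilbert function of the quotient of the polynomial ring by a homogeneous ideal.\<close>

definition hilbert_function :: "'k::field poly3 set \<Rightarrow> nat \<Rightarrow> nat" where
  "hilbert_function I t = quotient_dim poly3_scale (forms t) I"

text \<open>The degree of the zero-dimensional (or empty) scheme defined by a homogeneous ideal, which
  need not be saturated: its Hilbert polynomial, i.e. the eventual value of the Hilbert function.\<close>

definition scheme_degree :: "'k::field poly3 set \<Rightarrow> nat" where
  "scheme_degree I = (THE d. \<forall>\<^sub>F t in sequentially. hilbert_function I t = d)"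

section \<open>Fat points\<close>

definition point_ideal :: "'k::field proj_plane \<Rightarrow> 'k poly3 set" where
  "point_ideal P = ideal_gen {f. (\<exists>d. f \<in> forms d) \<and> vanishes_at f P}"

text \<open>The set of fat points \<open>m\<^sub>1 P\<^sub>1 + \<dots> + m\<^sub>s P\<^sub>s\<close> is the multiset in which
  each \<open>P\<^sub>i\<close> occurs \<open>m\<^sub>i\<close> times.\<close>

definition fat_ideal :: "'k::field proj_plane multiset \<Rightarrow> 'k poly3 set" where
  "fat_ideal Z = (\<Inter>P\<in>set_mset Z. ideal_power (point_ideal P) (count Z P))"

definition double_point :: "'k::field proj_plane multiset \<Rightarrow> 'k proj_plane \<Rightarrow> bool" where
  "double_point Z P \<longleftrightarrow> count Z P = 2"

definition reduced_point :: "'k::field proj_plane multiset \<Rightarrow> 'k proj_plane \<Rightarrow> bool" where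
  "reduced_point Z P \<longleftrightarrow> count Z P = 1"

end

theory Submission
  imports Defs
begin

text \<open>
  Cut \<open>Z\<close> with the lines one after the other. If \<open>L\<close> is the equation of the next line and \<open>W\<close> is what
  is left of \<open>Z\<close>, multiplication by \<open>L\<close> gives
  \<open>H\<^sub>W(t) = H\<^sub>W\<^sub>:\<^sub>L(t - 1) + dim (R / (I\<^sub>W + L))\<^sub>t\<close>
  (\<open>hilbert_function_fat_ideal_Suc\<close>), and the last term can be estimated on the line itself. It is at
  most \<open>t + 1\<close>, the number of monomials of degree \<open>t\<close> in two variables, and at least \<open>min (t + 1) e\<close>,
  where \<open>e\<close> is the degree of \<open>W\<close> on the line, because a nonzero polynomial of degree less than \<open>e\<close>
  in a parameter of the line cannot have \<open>e\<close> zeros, counted with multiplicity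
  (\<open>hilbert_function_mod_line_ge\<close>). In the other direction a point of multiplicity \<open>m\<close> imposes at
  most \<open>m (m + 1) / 2\<close> conditions (\<open>hilbert_function_le_fat_degree\<close>).

  When the degrees \<open>e\<^sub>1 > e\<^sub>2 > \<dots>\<close> on the successive lines decrease strictly and the lines exhaust
  \<open>Z\<close>, these bounds meet: \<open>H\<^sub>Z(t)\<close> is the sum of the numbers \<open>min (t + 2 - a) e\<^sub>a\<close>, with the terms
  of negative \<open>t + 2 - a\<close> omitted (\<open>hilbert_function_strictly_decreasing\<close>). So \<open>H\<^sub>Z\<close> depends only on
  the sequence of degrees. Passing from \<open>Z\<close> to \<open>Z'\<close> does not change this sequence
  (\<open>line_degrees_trade\<close>): line \<open>i\<close> exchanges two simple points for one point of multiplicity two,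
  of which one unit survives, and line \<open>j\<close> exchanges one simple point for that unit.

  Two facts connect this with the algebra. The colon ideal of a fat point ideal by a line is again a
  fat point ideal, with multiplicities lowered along the line (\<open>ideal_colon_fat_ideal\<close>). This is read
  off from a description of the powers of the ideal of a point by the order of vanishing of the local
  expansion at that point (\<open>form_in_point_ideal_power_iff\<close>). And the degree of the scheme defined by
  \<open>I\<^sub>W + L\<close>, an eventual value of a Hilbert function, is the combinatorial degree of \<open>W\<close> on the line
  (\<open>scheme_degree_line_section\<close>). It is the difference of the eventual values of \<open>H\<^sub>W\<close> and of
  \<open>H\<^sub>W\<^sub>:\<^sub>L\<close>, which are the full numbers of conditions by the same two bounds, now applied to enough
  lines to exhaust \<open>W\<close>.
\<close>

section \<open>Dimension of a quotient of vector spaces\<close>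

text \<open>Gaussian elimination of one equation at a time; every comparison of dimensions below rests
  on this fact.\<close>

lemma underdetermined_system:
  fixes M :: "'i \<Rightarrow> 'j \<Rightarrow> 'k::field"
  assumes "finite J" "finite A" "card J < card A"
  shows "\<exists>c. (\<exists>i\<in>A. c i \<noteq> 0) \<and> (\<forall>j\<in>J. (\<Sum>i\<in>A. c i * M i j) = 0)"
  using assms
proof (induction J arbitrary: A M rule: finite_induct)
  case empty
  then have "A \<noteq> {}" by auto
  then show ?case by (intro exI[of _ "\<lambda>_. 1"]) auto
next
  case (insert j0 J)
  show ?case
  proof (cases "\<forall>i\<in>A. M i j0 = 0")
    case True
    from insert obtain c where "\<exists>i\<in>A. c i \<noteq> 0" "\<forall>j\<in>J. (\<Sum>i\<in>A. c i * M i j) = 0"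
      by (metis card_insert_disjoint Suc_lessD)
    with True show ?thesis by (intro exI[of _ c]) auto
  next
    case False
    then obtain p where p: "p \<in> A" "M p j0 \<noteq> 0" by auto
    define N where "N i j = M i j - M i j0 * (M p j / M p j0)" for i j
    have "card J < card (A - {p})"
      using insert p by simp
    then obtain c where c: "\<exists>i\<in>A - {p}. c i \<noteq> 0" "\<forall>j\<in>J. (\<Sum>i\<in>A - {p}. c i * N i j) = 0"
      using insert.IH[of "A - {p}" N] insert.prems by auto
    define c' where "c' i = (if i = p then - (\<Sum>i\<in>A - {p}. c i * M i j0) / M p j0 else c i)" for i
    have split: "(\<Sum>i\<in>A. c' i * M i j) = c' p * M p j + (\<Sum>i\<in>A - {p}. c i * M i j)" for j
      using insert.prems p by (subst sum.remove[of A p]) (auto simp: c'_def intro!: sum.cong)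
    have "(\<Sum>i\<in>A - {p}. c i * N i j)
        = (\<Sum>i\<in>A - {p}. c i * M i j) - (\<Sum>i\<in>A - {p}. c i * M i j0) * (M p j / M p j0)" for j
      unfolding N_def sum_distrib_right sum_subtractf[symmetric] right_diff_distrib mult.assoc ..
    then have "(\<Sum>i\<in>A. c' i * M i j) = (\<Sum>i\<in>A - {p}. c i * N i j)" for j
      unfolding split by (simp add: c'_def)
    moreover have "(\<Sum>i\<in>A - {p}. c i * N i j0) = 0"
      using p(2) by (simp add: N_def)
    moreover have "\<exists>i\<in>A. c' i \<noteq> 0" using c(1) by (auto simp: c'_def)
    ultimately show ?thesis using c(2) by (intro exI[of _ c']) auto
  qed
qed

text \<open>Independence and generation modulo a subspace are stated for indexed families, because the
  families of interest are indexed by exponents or by a disjoint union, where images would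
  require injectivity.\<close>

definition indep_mod ::
  "('k::field \<Rightarrow> 'v::ab_group_add \<Rightarrow> 'v) \<Rightarrow> 'v set \<Rightarrow> 'i set \<Rightarrow> ('i \<Rightarrow> 'v) \<Rightarrow> bool" where
  "indep_mod smul W J g \<longleftrightarrow> (\<forall>c. (\<Sum>j\<in>J. smul (c j) (g j)) \<in> W \<longrightarrow> (\<forall>j\<in>J. c j = 0))"

definition spans_mod ::
  "('k::field \<Rightarrow> 'v::ab_group_add \<Rightarrow> 'v) \<Rightarrow> 'v set \<Rightarrow> 'v set \<Rightarrow>
    'i set \<Rightarrow> ('i \<Rightarrow> 'v) \<Rightarrow> bool" where
  "spans_mod smul V W J g \<longleftrightarrow> (\<forall>v\<in>V. \<exists>c. v - (\<Sum>j\<in>J. smul (c j) (g j)) \<in> W)"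

context vector_space
begin

lemma indep_mod_card_le_spans_mod:
  assumes W: "subspace W" and fin: "finite A" "finite J"
    and indep: "indep_mod scale W A a" and aV: "\<And>i. i \<in> A \<Longrightarrow> a i \<in> V" and spans: "spans_mod scale V W J g"
  shows "card A \<le> card J"
proof (rule ccontr)
  assume gt: "\<not> ?thesis"
  have "\<forall>i\<in>A. \<exists>c. a i - (\<Sum>j\<in>J. scale (c j) (g j)) \<in> W"
    using aV spans by (auto simp: spans_mod_def)
  then obtain M where M: "\<And>i. i \<in> A \<Longrightarrow> a i - (\<Sum>j\<in>J. scale (M i j) (g j)) \<in> W"
    by metis
  obtain c where c: "\<exists>i\<in>A. c i \<noteq> 0" "\<forall>j\<in>J. (\<Sum>i\<in>A. c i * M i j) = 0"
    using underdetermined_system[of J A M] fin gt by auto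
  have "(\<Sum>i\<in>A. \<Sum>j\<in>J. scale (c i * M i j) (g j)) = (\<Sum>j\<in>J. scale (\<Sum>i\<in>A. c i * M i j) (g j))"
    by (subst sum.swap) (simp add: scale_sum_left)
  also have "\<dots> = 0"
    using c(2) by (simp add: sum.neutral)
  finally have "(\<Sum>i\<in>A. scale (c i) (a i)) = (\<Sum>i\<in>A. scale (c i) (a i - (\<Sum>j\<in>J. scale (M i j) (g j))))"
    by (simp add: scale_right_diff_distrib sum_subtractf scale_sum_right)
  also have "\<dots> \<in> W"
    using M by (intro subspace_sum[OF W] subspace_scale[OF W]) auto
  finally show False using indep c(1) by (auto simp: indep_mod_def)
qed

lemma indep_mod_card_le_functionals:
  fixes \<phi> :: "'j \<Rightarrow> 'b \<Rightarrow> 'a"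
  assumes V: "subspace V" and fin: "finite A" "finite J"
    and indep: "indep_mod scale W A a" and aV: "\<And>i. i \<in> A \<Longrightarrow> a i \<in> V"
    and add: "\<And>j v w. j \<in> J \<Longrightarrow> \<phi> j (v + w) = \<phi> j v + \<phi> j w"
    and scale: "\<And>j c v. j \<in> J \<Longrightarrow> \<phi> j (scale c v) = c * \<phi> j v"
    and ker: "\<And>v. v \<in> V \<Longrightarrow> (\<And>j. j \<in> J \<Longrightarrow> \<phi> j v = 0) \<Longrightarrow> v \<in> W"
  shows "card A \<le> card J"
proof (rule ccontr)
  assume gt: "\<not> ?thesis"
  obtain c where c: "\<exists>i\<in>A. c i \<noteq> 0" "\<forall>j\<in>J. (\<Sum>i\<in>A. c i * \<phi> j (a i)) = 0"
    using underdetermined_system[of J A "\<lambda>i j. \<phi> j (a i)"] fin gt by auto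
  have zero: "\<phi> j 0 = 0" if "j \<in> J" for j
    using scale[OF that, of 0 0] by simp
  have "\<phi> j (\<Sum>i\<in>B. scale (c i) (a i)) = (\<Sum>i\<in>B. c i * \<phi> j (a i))" if "j \<in> J" for j B
    by (induction B rule: infinite_finite_induct) (simp_all add: zero add scale that)
  moreover have "(\<Sum>i\<in>A. scale (c i) (a i)) \<in> V"
    using aV by (intro subspace_sum[OF V] subspace_scale[OF V])
  ultimately have "(\<Sum>i\<in>A. scale (c i) (a i)) \<in> W"
    using c(2) by (intro ker) auto
  then show False using indep c(1) by (auto simp: indep_mod_def)
qed

lemma quotient_basis_iff:
  assumes V: "subspace V" and W: "subspace W"
  shows "quotient_basis scale V W B \<longleftrightarrow>
    finite B \<and> B \<subseteq> V \<and> indep_mod scale W B (\<lambda>b. b) \<and> spans_mod scale V W B (\<lambda>b. b)"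
proof (cases "finite B \<and> B \<subseteq> V")
  case True
  then have B: "finite B" "B \<subseteq> V" by auto
  have "(\<forall>v\<in>V. \<exists>!c. (\<forall>b. b \<notin> B \<longrightarrow> c b = 0) \<and> v - (\<Sum>b\<in>B. scale (c b) b) \<in> W) \<longleftrightarrow>
      indep_mod scale W B (\<lambda>b. b) \<and> spans_mod scale V W B (\<lambda>b. b)" (is "?L \<longleftrightarrow> ?R")
  proof
    assume L: ?L
    have "indep_mod scale W B (\<lambda>b. b)"
      unfolding indep_mod_def
    proof (intro allI impI)
      fix c assume c: "(\<Sum>j\<in>B. scale (c j) j) \<in> W"
      define c' where "c' b = (if b \<in> B then - c b else 0)" for b
      have unique: "e = e'" if "\<forall>b. b \<notin> B \<longrightarrow> e b = 0" "0 - (\<Sum>b\<in>B. scale (e b) b) \<in> W"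
        "\<forall>b. b \<notin> B \<longrightarrow> e' b = 0" "0 - (\<Sum>b\<in>B. scale (e' b) b) \<in> W" for e e'
        using bspec[OF L subspace_0[OF V]] that by (elim ex1E) metis
      have "c' = (\<lambda>_. 0)"
        using c subspace_0[OF W] by (intro unique) (simp_all add: c'_def sum_negf)
      then show "\<forall>b\<in>B. c b = 0" by (auto simp: c'_def fun_eq_iff split: if_splits)
    qed
    moreover have "spans_mod scale V W B (\<lambda>b. b)"
      using L unfolding spans_mod_def by blast
    ultimately show ?R by blast
  next
    assume R: ?R
    show ?L
    proof
      fix v assume v: "v \<in> V"
      obtain c where c: "v - (\<Sum>b\<in>B. scale (c b) b) \<in> W"
        using R v by (auto simp: spans_mod_def)
      define c' where "c' b = (if b \<in> B then c b else 0)" for b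
      show "\<exists>!c. (\<forall>b. b \<notin> B \<longrightarrow> c b = 0) \<and> v - (\<Sum>b\<in>B. scale (c b) b) \<in> W"
      proof (rule ex1I[of _ c'])
        show "(\<forall>b. b \<notin> B \<longrightarrow> c' b = 0) \<and> v - (\<Sum>b\<in>B. scale (c' b) b) \<in> W"
          using c by (simp add: c'_def)
      next
        fix d assume d: "(\<forall>b. b \<notin> B \<longrightarrow> d b = 0) \<and> v - (\<Sum>b\<in>B. scale (d b) b) \<in> W"
        have "(v - (\<Sum>b\<in>B. scale (c b) b)) - (v - (\<Sum>b\<in>B. scale (d b) b)) \<in> W"
          using subspace_diff[OF W c] d by blast
        then have "(\<Sum>b\<in>B. scale (d b - c b) b) \<in> W"
          by (simp add: scale_left_diff_distrib sum_subtractf)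
        then have "\<forall>b\<in>B. d b - c b = 0"
          using R by (auto simp: indep_mod_def)
        then show "d = c'" using d by (auto simp: c'_def fun_eq_iff)
      qed
    qed
  qed
  with B show ?thesis unfolding quotient_basis_def by blast
qed (auto simp: quotient_basis_def)

text \<open>A family that is independent modulo \<open>W\<close> of maximal size spans: if some vector were missed,
  it could be added to the family.\<close>

lemma quotient_basis_exists:
  assumes V: "subspace V" and W: "subspace W" and fin: "finite J" and spans: "spans_mod scale V W J g"
  obtains B where "quotient_basis scale V W B"
proof -
  define Q where "Q B \<longleftrightarrow> finite B \<and> B \<subseteq> V \<and> indep_mod scale W B (\<lambda>b. b)" for B
  have bound: "card B \<le> card J" if "Q B" for B
    using that indep_mod_card_le_spans_mod[OF W _ fin _ _ spans, of B "\<lambda>b. b"] by (auto simp: Q_def)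
  have "Q {}" by (simp add: Q_def indep_mod_def)
  then obtain B where B: "Q B" and max: "\<And>B'. Q B' \<Longrightarrow> card B' \<le> card B"
    using ex_has_greatest_nat[of Q "{}" card "Suc (card J)"] bound by (meson le_imp_less_Suc)
  have "spans_mod scale V W B (\<lambda>b. b)"
    unfolding spans_mod_def
  proof (rule ccontr)
    assume "\<not> (\<forall>v\<in>V. \<exists>c. v - (\<Sum>b\<in>B. scale (c b) b) \<in> W)"
    then obtain v where v: "v \<in> V" "\<And>c. v - (\<Sum>b\<in>B. scale (c b) b) \<notin> W" by blast
    have "v \<notin> B"
    proof
      assume "v \<in> B"
      then have "(\<Sum>b\<in>B. scale (if b = v then 1 else 0) b) = (\<Sum>b\<in>{v}. scale (if b = v then 1 else 0) b)"
        using B by (intro sum.mono_neutral_right) (auto simp: Q_def)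
      then show False using v(2)[of "\<lambda>b. if b = v then 1 else 0"] subspace_0[OF W] by simp
    qed
    have "indep_mod scale W (insert v B) (\<lambda>b. b)"
      unfolding indep_mod_def
    proof (intro allI impI)
      fix c assume "(\<Sum>b\<in>insert v B. scale (c b) b) \<in> W"
      then have c: "scale (c v) v + (\<Sum>b\<in>B. scale (c b) b) \<in> W"
        using B \<open>v \<notin> B\<close> by (simp add: Q_def)
      have "c v = 0"
      proof (rule ccontr)
        assume nz: "c v \<noteq> 0"
        have "scale (1 / c v) (scale (c v) v + (\<Sum>b\<in>B. scale (c b) b)) \<in> W"
          using c by (rule subspace_scale[OF W])
        also have "scale (1 / c v) (scale (c v) v + (\<Sum>b\<in>B. scale (c b) b))
            = v - (\<Sum>b\<in>B. scale (- c b / c v) b)"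
          using nz by (simp add: scale_right_distrib scale_sum_right sum_negf)
        finally show False using v(2)[of "\<lambda>b. - c b / c v"] by blast
      qed
      with c have "(\<Sum>b\<in>B. scale (c b) b) \<in> W" by simp
      with B \<open>c v = 0\<close> show "\<forall>b\<in>insert v B. c b = 0" by (auto simp: Q_def indep_mod_def)
    qed
    then have "Q (insert v B)" using B v by (simp add: Q_def)
    then show False using max[of "insert v B"] B \<open>v \<notin> B\<close> by (simp add: Q_def)
  qed
  then show ?thesis
    using B that by (auto simp: quotient_basis_iff[OF V W] Q_def)
qed

lemma quotient_dim_eq:
  assumes V: "subspace V" and W: "subspace W" and B: "quotient_basis scale V W B"
  shows "quotient_dim scale V W = card B"
  unfolding quotient_dim_def
proof (rule the_equality)
  show "\<exists>B'. quotient_basis scale V W B' \<and> card B' = card B" using B by blast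
next
  fix n assume "\<exists>B'. quotient_basis scale V W B' \<and> card B' = n"
  then obtain B' where B': "quotient_basis scale V W B'" "card B' = n" by blast
  have *: "card B1 \<le> card B2" if "quotient_basis scale V W B1" "quotient_basis scale V W B2" for B1 B2
    using that unfolding quotient_basis_iff[OF V W]
    by (intro indep_mod_card_le_spans_mod[OF W, of B1 B2 "\<lambda>b. b" V "\<lambda>b. b"]) auto
  show "n = card B" using *[OF B B'(1)] *[OF B'(1) B] B'(2) by simp
qed

end

text \<open>Finite generation ensures that the quotient has a finite basis.\<close>

locale finite_quotient = vector_space scale for scale :: "'a::field \<Rightarrow> 'b::ab_group_add \<Rightarrow> 'b" +
  fixes V W :: "'b set"
  assumes subspace_V: "subspace V" and subspace_W: "subspace W"
    and finitely_generated: "\<exists>S. finite S \<and> V \<subseteq> span S"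
begin

lemma obtain_basis:
  obtains B where "finite B" "B \<subseteq> V" "indep_mod scale W B (\<lambda>b. b)" "spans_mod scale V W B (\<lambda>b. b)"
    "quotient_dim scale V W = card B"
proof -
  obtain S where S: "finite S" "V \<subseteq> span S" using finitely_generated by blast
  have "spans_mod scale V W S (\<lambda>b. b)"
    unfolding spans_mod_def
  proof
    fix v assume "v \<in> V"
    then obtain u where "v = (\<Sum>b\<in>S. scale (u b) b)"
      using S span_finite[OF S(1)] by auto
    then show "\<exists>c. v - (\<Sum>b\<in>S. scale (c b) b) \<in> W"
      using subspace_0[OF subspace_W] by (intro exI[of _ u]) simp
  qed
  then obtain B where B: "quotient_basis scale V W B"
    using quotient_basis_exists[OF subspace_V subspace_W S(1)] by blast
  show ?thesis
    using B quotient_dim_eq[OF subspace_V subspace_W B]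
    unfolding quotient_basis_iff[OF subspace_V subspace_W] by (intro that) auto
qed

lemma quotient_dim_ge:
  assumes "finite J" "\<And>j. j \<in> J \<Longrightarrow> g j \<in> V" "indep_mod scale W J g"
  shows "card J \<le> quotient_dim scale V W"
proof -
  obtain B where B: "finite B" "B \<subseteq> V" "indep_mod scale W B (\<lambda>b. b)" "spans_mod scale V W B (\<lambda>b. b)"
    "quotient_dim scale V W = card B"
    by (rule obtain_basis)
  show ?thesis
    using indep_mod_card_le_spans_mod[OF subspace_W assms(1) B(1) assms(3) _ B(4)] assms(2) B(5) by simp
qed

lemma quotient_dim_le:
  assumes "finite J" "spans_mod scale V W J g"
  shows "quotient_dim scale V W \<le> card J"
proof -
  obtain B where B: "finite B" "B \<subseteq> V" "indep_mod scale W B (\<lambda>b. b)" "spans_mod scale V W B (\<lambda>b. b)"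
    "quotient_dim scale V W = card B"
    by (rule obtain_basis)
  show ?thesis
    using indep_mod_card_le_spans_mod[OF subspace_W B(1) assms(1) B(3) _ assms(2)] B(2,5) by auto
qed

lemma quotient_dim_eq_card:
  assumes "finite J" "\<And>j. j \<in> J \<Longrightarrow> g j \<in> V" "indep_mod scale W J g" "spans_mod scale V W J g"
  shows "quotient_dim scale V W = card J"
  by (intro antisym quotient_dim_ge[where g = g] quotient_dim_le[where g = g] assms)

lemma quotient_dim_le_functionals:
  fixes \<phi> :: "'j \<Rightarrow> 'b \<Rightarrow> 'a"
  assumes "finite J"
    and "\<And>j v w. j \<in> J \<Longrightarrow> \<phi> j (v + w) = \<phi> j v + \<phi> j w"
    and "\<And>j c v. j \<in> J \<Longrightarrow> \<phi> j (scale c v) = c * \<phi> j v"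
    and "\<And>v. v \<in> V \<Longrightarrow> (\<And>j. j \<in> J \<Longrightarrow> \<phi> j v = 0) \<Longrightarrow> v \<in> W"
  shows "quotient_dim scale V W \<le> card J"
proof -
  obtain B where B: "finite B" "B \<subseteq> V" "indep_mod scale W B (\<lambda>b. b)" "spans_mod scale V W B (\<lambda>b. b)"
    "quotient_dim scale V W = card B"
    by (rule obtain_basis)
  show ?thesis
    unfolding B(5) using B(2)
    by (intro indep_mod_card_le_functionals[where V = V and a = "\<lambda>b. b" and \<phi> = \<phi>,
          OF subspace_V B(1) assms(1) B(3) _ assms(2-4)]) auto
qed

end

section \<open>Evaluation of forms and dual coordinates\<close>

interpretation poly3: vector_space poly3_scale
  by unfold_locales
    (simp_all add: poly3_scale_def algebra_simps single_add mult_single flip: mult.assoc single_one)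

lemma poly3_scale_mult: "poly3_scale c f * g = poly3_scale c (f * g)"
  "f * poly3_scale c g = poly3_scale c (f * g)"
  by (simp_all add: poly3_scale_def algebra_simps)

abbreviation mdeg :: "(3 \<Rightarrow>\<^sub>0 nat) \<Rightarrow> nat" where
  "mdeg m \<equiv> \<Sum>i\<in>UNIV. Poly_Mapping.lookup m i"

lemma mdeg_add: "mdeg (m + m') = mdeg m + mdeg m'"
  by (simp add: lookup_add sum.distrib)

lemma mdeg_single: "mdeg (Poly_Mapping.single q k) = k"
  by (simp add: lookup_single when_def)

lemma poly3_expand:
  "f = (\<Sum>m\<in>Poly_Mapping.keys f. Poly_Mapping.single m (Poly_Mapping.lookup f m))"
  by (rule poly_mapping_eqI)
    (simp add: lookup_sum lookup_single when_def sum.delta in_keys_iff)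

lemma forms_iff: "f \<in> forms t \<longleftrightarrow> (\<forall>m. Poly_Mapping.lookup f m \<noteq> 0 \<longrightarrow> mdeg m = t)"
  unfolding forms_def in_keys_iff Ball_def by simp

lemma subspace_forms: "poly3.subspace (forms t)"
  unfolding poly3.subspace_def
proof (intro conjI ballI allI)
  fix f g :: "'a poly3" and c assume "f \<in> forms t" 
  then show "poly3_scale c f \<in> forms t"
    using keys_mult[of "Poly_Mapping.single 0 c" f] 
    by (fastforce simp: forms_def poly3_scale_def split: if_splits)
  assume "g \<in> forms t" with \<open>f \<in> forms t\<close> show "f + g \<in> forms t"
    using keys_add[of f g] by (auto simp: forms_def)
qed (simp add: forms_def)

lemma forms_mult:
  assumes "f \<in> forms s" "g \<in> forms t"
  shows "f * g \<in> forms (s + t)"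
proof -
  have "mdeg m = s + t" if m: "m \<in> Poly_Mapping.keys (f * g)" for m
  proof -
    obtain a b where "m = a + b" "a \<in> Poly_Mapping.keys f" "b \<in> Poly_Mapping.keys g"
      using keys_mult[of f g] m by blast
    then show ?thesis using assms by (simp add: forms_def mdeg_add)
  qed
  then show ?thesis by (simp add: forms_def)
qed

lemma one_in_forms: "1 \<in> forms 0"
  by (simp add: forms_def)

lemma forms_power: "f \<in> forms s \<Longrightarrow> f ^ n \<in> forms (n * s)"
  by (induction n) (simp_all add: one_in_forms forms_mult)

definition var :: "3 \<Rightarrow> 'k::field poly3" where
  "var q = Poly_Mapping.single (Poly_Mapping.single q 1) 1"

lemma var_in_forms: "var q \<in> forms 1"
  by (simp add: forms_def var_def mdeg_single)

lemma mdeg_Suc_split: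
  assumes "mdeg m = Suc t"
  obtains q m' where "m = Poly_Mapping.single q 1 + m'" "mdeg m' = t"
proof -
  obtain q where q: "Poly_Mapping.lookup m q \<noteq> 0"
    using assms by (metis sum.neutral nat.distinct(1))
  define m' where "m' = m - Poly_Mapping.single q 1"
  have "m = Poly_Mapping.single q 1 + m'"
    using q by (intro poly_mapping_eqI) (auto simp: m'_def lookup_add lookup_minus lookup_single when_def)
  moreover from this have "mdeg m' = t"
    using assms mdeg_add[of "Poly_Mapping.single q 1" m'] by (simp add: mdeg_single)
  ultimately show ?thesis by (rule that)
qed

lemma linear_expand:
  assumes "L \<in> forms 1"
  shows "L = (\<Sum>q\<in>UNIV. poly3_scale (Poly_Mapping.lookup L (Poly_Mapping.single q 1)) (var q))"
proof (rule poly_mapping_eqI)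
  fix m
  have *: "Poly_Mapping.lookup (poly3_scale c (var q)) m =
      (if m = Poly_Mapping.single q 1 then c else 0)" for c :: 'a and q
    by (simp add: poly3_scale_def var_def mult_single lookup_single when_def eq_commute)
  show "Poly_Mapping.lookup L m =
      Poly_Mapping.lookup (\<Sum>q\<in>UNIV. poly3_scale (Poly_Mapping.lookup L (Poly_Mapping.single q 1)) (var q)) m"
  proof (cases "mdeg m = 1")
    case True
    then obtain p m' where "m = Poly_Mapping.single p 1 + m'" "mdeg m' = 0"
      by (metis One_nat_def mdeg_Suc_split)
    moreover from this have "m' = 0" by (intro poly_mapping_eqI) simp
    ultimately have m: "m = Poly_Mapping.single p 1" by simp
    have "Poly_Mapping.single p (1::nat) = Poly_Mapping.single q 1 \<longleftrightarrow> q = p" for q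
      by (auto dest: arg_cong[of _ _ "\<lambda>f. Poly_Mapping.lookup f p"]
          simp: lookup_single when_def split: if_splits)
    then show ?thesis
      unfolding lookup_sum * by (simp add: m sum.delta)
  next
    case False
    then have "Poly_Mapping.lookup L m = 0" using assms by (auto simp: forms_iff)
    moreover have "m \<noteq> Poly_Mapping.single q 1" for q using False mdeg_single[of q 1] by auto
    ultimately show ?thesis unfolding lookup_sum * by simp
  qed
qed

subsection \<open>Evaluation homomorphisms\<close>

text \<open>Evaluation at arguments in an arbitrary commutative ring. Besides points of the plane the
  arguments below are the generic point of a line and the generic point of a pencil of lines, whose
  coordinates are polynomials.\<close>

definition subst :: "('k::field \<Rightarrow> 'a::comm_ring_1) \<Rightarrow> (3 \<Rightarrow> 'a) \<Rightarrow> 'k poly3 \<Rightarrow> 'a" where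
  "subst h x f = (\<Sum>m\<in>Poly_Mapping.keys f.
     h (Poly_Mapping.lookup f m) * (\<Prod>i\<in>UNIV. x i ^ Poly_Mapping.lookup m i))"

locale coefficient_hom =
  fixes h :: "'k::field \<Rightarrow> 'a::comm_ring_1"
  assumes h_add: "h (a + b) = h a + h b" and h_mult: "h (a * b) = h a * h b" and h_one: "h 1 = 1"
begin

lemma h_zero: "h 0 = 0"
  using h_add[of 0 0] by simp

lemma subst_superset:
  "finite A \<Longrightarrow> Poly_Mapping.keys f \<subseteq> A \<Longrightarrow> subst h x f =
    (\<Sum>m\<in>A. h (Poly_Mapping.lookup f m) * (\<Prod>i\<in>UNIV. x i ^ Poly_Mapping.lookup m i))"
  unfolding subst_def by (rule sum.mono_neutral_left) (auto simp: in_keys_iff h_zero)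

lemma subst_add: "subst h x (f + g) = subst h x f + subst h x g"
proof -
  let ?A = "Poly_Mapping.keys f \<union> Poly_Mapping.keys g"
  have "Poly_Mapping.keys (f + g) \<subseteq> ?A" by (rule keys_add)
  then show ?thesis
    by (simp add: subst_superset[of ?A] lookup_add h_add sum.distrib algebra_simps)
qed

lemma subst_zero: "subst h x 0 = 0"
  by (simp add: subst_def)

lemma subst_sum: "subst h x (sum f A) = (\<Sum>a\<in>A. subst h x (f a))"
  by (induction A rule: infinite_finite_induct) (simp_all add: subst_add subst_zero)

lemma subst_single: "subst h x (Poly_Mapping.single m c) = h c * (\<Prod>i\<in>UNIV. x i ^ Poly_Mapping.lookup m i)"
  by (subst subst_superset[of "{m}"]) simp_all

lemma subst_mult: "subst h x (f * g) = subst h x f * subst h x g"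
proof -
  let ?s = "\<lambda>f m. Poly_Mapping.single m (Poly_Mapping.lookup f m)"
  have "subst h x (f * g) = subst h x ((\<Sum>m\<in>Poly_Mapping.keys f. ?s f m) * (\<Sum>m\<in>Poly_Mapping.keys g. ?s g m))"
    by (simp flip: poly3_expand)
  also have "\<dots> = (\<Sum>m\<in>Poly_Mapping.keys f. subst h x (?s f m)) *
      (\<Sum>m\<in>Poly_Mapping.keys g. subst h x (?s g m))"
    by (simp add: sum_product subst_sum mult_single subst_single h_mult lookup_add power_add
        prod.distrib algebra_simps)
  also have "\<dots> = subst h x f * subst h x g"
    by (simp flip: subst_sum poly3_expand)
  finally show ?thesis .
qed

lemma subst_one: "subst h x 1 = 1"
  using subst_single[of x 0 1] by (simp add: h_one)

lemma subst_power: "subst h x (f ^ n) = subst h x f ^ n"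
  by (induction n) (simp_all add: subst_one subst_mult)

lemma subst_scale: "subst h x (poly3_scale c f) = h c * subst h x f"
  by (simp add: poly3_scale_def subst_mult subst_single)

lemma subst_var: "subst h x (var q) = x q"
  by (simp add: var_def subst_single h_one lookup_single when_def
      if_distrib[of "(^) _"] prod.delta cong: if_cong)

lemma subst_linear:
  assumes "L \<in> forms 1"
  shows "subst h x L = (\<Sum>q\<in>UNIV. h (Poly_Mapping.lookup L (Poly_Mapping.single q 1)) * x q)"
  by (subst linear_expand[OF assms]) (simp add: subst_sum subst_scale subst_var)

end

interpretation eval: coefficient_hom "\<lambda>c. c"
  by unfold_locales auto

lemma poly3_eval_subst: "poly3_eval f v = subst (\<lambda>c. c) (\<lambda>i. v $ i) f"
  by (simp add: poly3_eval_def subst_def)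

lemma eval_form_scale:
  assumes "f \<in> forms t"
  shows "poly3_eval f (c *s v) = c ^ t * poly3_eval f v"
proof -
  have "(\<Prod>i\<in>UNIV. (c * v $ i) ^ Poly_Mapping.lookup m i) =
      c ^ t * (\<Prod>i\<in>UNIV. v $ i ^ Poly_Mapping.lookup m i)"
    if "m \<in> Poly_Mapping.keys f" for m
  proof -
    have "mdeg m = t" using assms that by (simp add: forms_def)
    then show ?thesis by (simp add: power_mult_distrib prod.distrib flip: power_sum)
  qed
  then show ?thesis by (simp add: poly3_eval_def sum_distrib_left mult.left_commute)
qed

text \<open>The restriction of a form to the line through \<open>u\<close> and \<open>w\<close>, in the affine parameter \<open>s\<close> of
  the point \<open>u + s w\<close>.\<close>

definition line_restrict :: "'k::field ^ 3 \<Rightarrow> 'k ^ 3 \<Rightarrow> 'k poly3 \<Rightarrow> 'k poly" where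
  "line_restrict u w = subst (\<lambda>c. [:c:]) (\<lambda>q. [:u $ q, w $ q:])"

text \<open>The expansion of a form at the point \<open>u\<close>: its value at \<open>u + s (v + z w)\<close> as a polynomial in
  \<open>s\<close> with coefficients in \<open>k[z]\<close>. The coefficient of \<open>s\<^sup>r\<close> is the dehomogenised
  homogeneous part of degree \<open>r\<close> of the local equation.\<close>

definition local_expansion :: "'k::field ^ 3 \<Rightarrow> 'k ^ 3 \<Rightarrow> 'k ^ 3 \<Rightarrow> 'k poly3 \<Rightarrow> 'k poly poly" where
  "local_expansion u v w = subst (\<lambda>c. [:[:c:]:]) (\<lambda>q. [:[:u $ q:], [:v $ q, w $ q:]:])"

interpretation restr: coefficient_hom "\<lambda>c. [:c:]"
  by unfold_locales (auto simp: one_pCons)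

interpretation expn: coefficient_hom "\<lambda>c. [:[:c:]:]"
  by unfold_locales (auto simp: one_pCons)

lemma line_restrict_linear:
  assumes "L \<in> forms 1"
  shows "line_restrict u w L = [:poly3_eval L u, poly3_eval L w:]"
  unfolding line_restrict_def poly3_eval_subst restr.subst_linear[OF assms] eval.subst_linear[OF assms]
  by (simp add: sum_3)

lemma local_expansion_linear:
  assumes "L \<in> forms 1"
  shows "local_expansion u v w L = [:[:poly3_eval L u:], [:poly3_eval L v, poly3_eval L w:]:]"
  unfolding local_expansion_def poly3_eval_subst expn.subst_linear[OF assms] eval.subst_linear[OF assms]
  by (simp add: sum_3)

lemma poly_line_restrict: "poly (line_restrict u w f) c = poly3_eval f (u + c *s w)"
  by (simp add: line_restrict_def poly3_eval_def subst_def poly_sum poly_prod)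

lemma coeff_0_local_expansion: "coeff (local_expansion u v w f) 0 = [:poly3_eval f u:]"
proof -
  have const: "(\<Sum>m\<in>A. [:p m:]) = [:\<Sum>m\<in>A. p m:]" for p :: "_ \<Rightarrow> 'a" and A :: "(3 \<Rightarrow>\<^sub>0 nat) set"
    by (induction A rule: infinite_finite_induct) auto
  have const_prod: "(\<Prod>i\<in>A. [:p i:]) = [:\<Prod>i\<in>A. p i:]" for p :: "_ \<Rightarrow> 'a" and A :: "3 set"
    by (induction A rule: infinite_finite_induct) (auto simp: one_pCons)
  have "poly (local_expansion u v w f) 0 = [:poly3_eval f u:]"
    by (simp add: local_expansion_def poly3_eval_def subst_def poly_sum poly_prod poly_const_pow const
        const_prod mult.commute)
  then show ?thesis by (simp add: poly_0_coeff_0)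
qed

subsection \<open>Dual coordinates\<close>

text \<open>A basis \<open>u\<close> of \<open>k\<^sup>3\<close> with its dual basis \<open>y\<close>, regarded as a system of homogeneous
  coordinates.\<close>

definition dual_frame :: "(3 \<Rightarrow> 'k::field poly3) \<Rightarrow> (3 \<Rightarrow> 'k ^ 3) \<Rightarrow> bool" where
  "dual_frame y u \<longleftrightarrow> (\<forall>i. y i \<in> forms 1) \<and>
     (\<forall>i j. poly3_eval (y i) (u j) = (if i = j then 1 else 0)) \<and>
     (\<forall>q. var q = (\<Sum>i\<in>UNIV. poly3_scale (u i $ q) (y i)))"

lemma dual_frame_exists:
  fixes u :: "3 \<Rightarrow> 'k::field ^ 3"
  assumes "\<And>c. (\<Sum>i\<in>UNIV. c i *s u i) = 0 \<Longrightarrow> \<forall>i. c i = 0"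
  shows "\<exists>y. dual_frame y u"
proof -
  define A :: "'k ^ 3 ^ 3" where "A = (\<chi> q i. u i $ q)"
  have "column i A = u i" for i by (simp add: A_def column_def vec_eq_iff)
  then obtain B where BA: "B ** A = mat 1"
    using assms matrix_left_invertible_independent_columns[of A] by auto
  then have AB: "A ** B = mat 1" using matrix_left_right_inverse by blast
  define y where "y i = (\<Sum>q\<in>UNIV. poly3_scale (B $ i $ q) (var q))" for i
  have "y i \<in> forms 1" for i
    unfolding y_def
    by (intro poly3.subspace_sum poly3.subspace_scale subspace_forms var_in_forms)
  moreover have "poly3_eval (y i) (u j) = (if i = j then 1 else 0)" for i j
  proof -
    have "poly3_eval (y i) (u j) = (B ** A) $ i $ j"
      by (simp add: poly3_eval_subst y_def eval.subst_sum eval.subst_scale eval.subst_var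
          matrix_matrix_mult_def A_def)
    then show ?thesis by (simp add: BA mat_def)
  qed
  moreover have "var q = (\<Sum>i\<in>UNIV. poly3_scale (u i $ q) (y i))" for q
  proof -
    have "(\<Sum>i\<in>UNIV. poly3_scale (u i $ q) (y i)) = (\<Sum>r\<in>UNIV. poly3_scale ((A ** B) $ q $ r) (var r))"
      unfolding y_def poly3.scale_sum_right matrix_matrix_mult_def A_def
      by (subst sum.swap) (simp add: poly3.scale_sum_left)
    also have "\<dots> = (\<Sum>r\<in>UNIV. if r = q then var r else 0)"
      by (intro sum.cong) (auto simp: AB mat_def)
    finally show ?thesis by simp
  qed
  ultimately show ?thesis unfolding dual_frame_def by blast
qed

lemma outside_span_exists:
  fixes v w :: "'k::field ^ 3"
  shows "\<exists>x. \<forall>a b. x \<noteq> a *s v + b *s w"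
proof -
  have "vec.span {v, w} \<noteq> (UNIV :: ('k ^ 3) set)"
  proof
    assume "vec.span {v, w} = (UNIV :: ('k ^ 3) set)"
    then have "vec.dim (UNIV :: ('k ^ 3) set) \<le> card {v, w}"
      by (intro vec.dim_le_card) auto
    also have "\<dots> \<le> 2" by (simp add: card_insert_if)
    finally show False by (simp add: vec.dim_UNIV card_cart_basis)
  qed
  then obtain x where "x \<notin> vec.span {v, w}" by auto
  then show ?thesis
    by (metis insertCI vec.span_add vec.span_base vec.span_scale)
qed

lemma vector_smult_eq_imp:
  fixes x y :: "'k::field ^ 3"
  assumes "c *s x + y = 0" "c \<noteq> 0"
  shows "x = (- 1 / c) *s y"
proof -
  have "c * x $ i = - y $ i" for i
    using assms(1) by (simp add: vec_eq_iff eq_neg_iff_add_eq_0)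
  then show ?thesis using assms(2) by (simp add: vec_eq_iff field_simps)
qed

lemma dual_frame_at:
  fixes v :: "'k::field ^ 3"
  assumes "v \<noteq> 0"
  obtains y u where "dual_frame y u" "u 1 = v"
proof -
  obtain x where x: "\<And>a b. x \<noteq> a *s v + b *s v"
    using outside_span_exists[of v v] by blast
  obtain z where z: "\<And>a b. z \<noteq> a *s v + b *s x"
    using outside_span_exists[of v x] by blast
  define u where "u i = (if i = 1 then v else if i = 2 then x else z)" for i :: 3
  have "\<exists>y. dual_frame y u"
  proof (rule dual_frame_exists)
    fix c assume "(\<Sum>i\<in>UNIV. c i *s u i) = 0"
    then have eq: "c 3 *s z + (c 2 *s x + c 1 *s v) = 0"
      by (simp add: sum_3 u_def algebra_simps)
    have c3: "c 3 = 0"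
    proof (rule ccontr)
      assume "c 3 \<noteq> 0"
      from vector_smult_eq_imp[OF eq this] z[of "- 1 / c 3 * c 1" "- 1 / c 3 * c 2"] show False
        by (simp add: vec.scale_right_distrib add.commute)
    qed
    have c2: "c 2 = 0"
    proof (rule ccontr)
      assume "c 2 \<noteq> 0"
      moreover have "c 2 *s x + c 1 *s v = 0" using eq c3 by simp
      ultimately show False using vector_smult_eq_imp x[of "- 1 / c 2 * c 1" 0] by fastforce
    qed
    have "c 1 = 0" using eq c2 c3 assms by simp
    then show "\<forall>i. c i = 0" using c2 c3 by (simp add: forall_3)
  qed
  then show ?thesis using that[of _ u] by (auto simp: u_def)
qed

lemma dual_frame_expand:
  assumes "dual_frame y u" "L \<in> forms 1"
  shows "L = (\<Sum>i\<in>UNIV. poly3_scale (poly3_eval L (u i)) (y i))"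
proof -
  let ?c = "\<lambda>q. Poly_Mapping.lookup L (Poly_Mapping.single q 1)"
  have "L = (\<Sum>q\<in>UNIV. poly3_scale (?c q) (\<Sum>i\<in>UNIV. poly3_scale (u i $ q) (y i)))"
    using linear_expand[OF assms(2)] assms(1) by (simp add: dual_frame_def)
  also have "\<dots> = (\<Sum>i\<in>UNIV. poly3_scale (\<Sum>q\<in>UNIV. ?c q * u i $ q) (y i))"
    unfolding poly3.scale_sum_right poly3.scale_sum_left
    by (subst sum.swap) simp
  finally show ?thesis
    by (simp add: poly3_eval_subst eval.subst_linear[OF assms(2)])
qed

text \<open>Only the exponents of the second and third coordinate are recorded, the exponent of the first one
  is determined by the degree. The first coordinate is a unit at the point \<open>u 1\<close>, so the recorded
  exponents measure the order of vanishing there.\<close>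

definition exponents :: "nat \<Rightarrow> (nat \<times> nat) set" where
  "exponents t = {(a, b). a + b \<le> t}"

lemma finite_exponents: "finite (exponents t)"
  by (rule finite_subset[of _ "{..t} \<times> {..t}"]) (auto simp: exponents_def)

definition frame_monomial :: "(3 \<Rightarrow> 'k::field poly3) \<Rightarrow> nat \<Rightarrow> nat \<times> nat \<Rightarrow> 'k poly3" where
  "frame_monomial y t p = y 1 ^ (t - fst p - snd p) * y 2 ^ fst p * y 3 ^ snd p"

text \<open>The coordinate forms of a frame generate the polynomial ring because the variables are
  linear combinations of them.\<close>

lemma forms_span_frame:
  assumes "dual_frame y u"
  shows "forms t \<subseteq> poly3.span (frame_monomial y t ` exponents t)"
proof -
  have step_y: "y i * f \<in> poly3.span (frame_monomial y (Suc t) ` exponents (Suc t))"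
    if "f \<in> poly3.span (frame_monomial y t ` exponents t)" for i f t
    using that
  proof (induction rule: poly3.span_induct_alt)
    case base
    show ?case by (simp add: poly3.span_zero)
  next
    case (step c g f)
    then obtain a b where ab: "a + b \<le> t" "g = y 1 ^ (t - a - b) * y 2 ^ a * y 3 ^ b"
      by (auto simp: exponents_def frame_monomial_def)
    have "i = 1 \<or> i = 2 \<or> i = 3" using exhaust_3 by blast
    then have "y i * g \<in> frame_monomial y (Suc t) ` exponents (Suc t)"
    proof (elim disjE)
      assume "i = 1"
      then show ?thesis using ab 
        by (intro image_eqI[of _ _ "(a, b)"])
            (auto simp: frame_monomial_def exponents_def Suc_diff_le algebra_simps simp flip: power_Suc)
    next
      assume "i = 2"
      then show ?thesis using ab 
        by (intro image_eqI[of _ _ "(Suc a, b)"])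
            (auto simp: frame_monomial_def exponents_def algebra_simps)
    next
      assume "i = 3"
      then show ?thesis using ab 
        by (intro image_eqI[of _ _ "(a, Suc b)"])
            (auto simp: frame_monomial_def exponents_def algebra_simps)
    qed
    moreover have "y i * (poly3_scale c g + f) = poly3_scale c (y i * g) + y i * f"
      by (simp add: distrib_left poly3_scale_mult)
    ultimately show ?case
      using step by (metis poly3.span_add poly3.span_base poly3.span_scale)
  qed
  have step_var: "var q * f \<in> poly3.span (frame_monomial y (Suc t) ` exponents (Suc t))"
    if "f \<in> poly3.span (frame_monomial y t ` exponents t)" for q f t
  proof -
    have "var q * f = (\<Sum>i\<in>UNIV. poly3_scale (u i $ q) (y i * f))"
      using assms by (simp add: dual_frame_def sum_distrib_right poly3_scale_mult)
    then show ?thesis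
      using step_y[OF that] by (simp add: poly3.span_sum poly3.span_scale)
  qed
  have monomials: "Poly_Mapping.single m 1 \<in> poly3.span (frame_monomial y t ` exponents t)"
    if "mdeg m = t" for m t
    using that
  proof (induction t arbitrary: m)
    case 0
    then have "m = 0" by (intro poly_mapping_eqI) simp
    moreover have "(1 :: 'a poly3) \<in> frame_monomial y 0 ` exponents 0"
      by (intro image_eqI[of _ _ "(0, 0)"]) (simp_all add: frame_monomial_def exponents_def)
    ultimately show ?case by (simp add: poly3.span_base)
  next
    case (Suc t)
    from Suc.prems obtain q m' where m: "m = Poly_Mapping.single q 1 + m'" "mdeg m' = t"
      by (rule mdeg_Suc_split)
    then have "(Poly_Mapping.single m 1 :: 'a poly3) = var q * Poly_Mapping.single m' 1"
      by (simp add: var_def mult_single)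
    then show ?case using step_var[OF Suc.IH[OF m(2)]] by simp
  qed
  show ?thesis
  proof
    fix f :: "'a poly3" assume f: "f \<in> forms t"
    have "f = (\<Sum>m\<in>Poly_Mapping.keys f. poly3_scale (Poly_Mapping.lookup f m) (Poly_Mapping.single m 1))"
      by (subst poly3_expand) (simp add: poly3_scale_def mult_single)
    also have "\<dots> \<in> poly3.span (frame_monomial y t ` exponents t)"
      using f by (intro poly3.span_sum poly3.span_scale monomials) (simp add: forms_def)
    finally show "f \<in> poly3.span (frame_monomial y t ` exponents t)" .
  qed
qed

lemma forms_frame_expand:
  assumes "dual_frame y u" "f \<in> forms t"
  obtains c where "f = (\<Sum>p\<in>exponents t. poly3_scale (c p) (frame_monomial y t p))"
proof -
  have "\<exists>c. f = (\<Sum>p\<in>exponents t. poly3_scale (c p) (frame_monomial y t p))"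
    using subsetD[OF forms_span_frame[OF assms(1)] assms(2)]
  proof (induction rule: poly3.span_induct_alt)
    case base
    show ?case by (intro exI[of _ "\<lambda>_. 0"]) simp
  next
    case (step c g f)
    then obtain p d where p: "p \<in> exponents t" "g = frame_monomial y t p"
      and d: "f = (\<Sum>p\<in>exponents t. poly3_scale (d p) (frame_monomial y t p))" by blast
    have "poly3_scale c g = (\<Sum>r\<in>exponents t. if r = p then poly3_scale c (frame_monomial y t r) else 0)"
      using p by (simp add: sum.delta finite_exponents)
    also have "\<dots> = (\<Sum>r\<in>exponents t. poly3_scale (if r = p then c else 0) (frame_monomial y t r))"
      by (intro sum.cong) auto
    finally show ?case
      by (intro exI[of _ "\<lambda>r. (if r = p then c else 0) + d r"])
        (simp add: d poly3.scale_left_distrib sum.distrib)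
  qed
  then show ?thesis using that by blast
qed

lemma finite_quotient_forms:
  assumes "poly3.subspace I"
  shows "finite_quotient poly3_scale (forms t) I"
proof
  have "(1 :: 'a ^ 3) \<noteq> 0" by simp
  then obtain y u where "dual_frame y (u :: 3 \<Rightarrow> 'a ^ 3)" using dual_frame_at by blast
  then show "\<exists>S :: 'a poly3 set. finite S \<and> forms t \<subseteq> poly3.span S"
    by (intro exI[of _ "frame_monomial y t ` exponents t"])
      (simp add: finite_exponents forms_span_frame)
qed (use assms subspace_forms in auto)

section \<open>Homogeneous ideals\<close>

interpretation ideal: module "(*) :: 'a::comm_ring_1 \<Rightarrow> 'a \<Rightarrow> 'a"
  by (rule module_times)

\<comment> \<open>as a rewrite rule this would undo associativity of multiplication\<close>
declare ideal.scale_scale [simp del]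

lemma ideal_gen_eq_span: "ideal_gen S = ideal.span S"
  by (simp add: ideal_gen_def)

lemma ideal_gen_singleton: "ideal_gen {L} = {h * L | h. True}"
  by (auto simp: ideal_gen_eq_span ideal.span_singleton)

lemma ideal_colon_principal:
  assumes "ideal.subspace I"
  shows "ideal_colon I (ideal_gen {L}) = {f. f * L \<in> I}"
proof -
  have "f * (h * L) \<in> I" if "f * L \<in> I" for f h
    using ideal.subspace_scale[OF assms that, of h] by (simp add: algebra_simps)
  moreover have "L = 1 * L" by simp
  ultimately show ?thesis unfolding ideal_colon_def ideal_gen_singleton by blast
qed

lemma subspace_ideal_sum:
  assumes I: "ideal.subspace I" and J: "ideal.subspace J"
  shows "ideal.subspace (ideal_sum I J)"
  unfolding ideal.subspace_def
proof (intro conjI ballI allI)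
  have "(0 :: 'a) = 0 + 0" by simp
  then show "0 \<in> ideal_sum I J"
    using ideal.subspace_0[OF I] ideal.subspace_0[OF J] unfolding ideal_sum_def by blast
next
  fix x y assume "x \<in> ideal_sum I J" "y \<in> ideal_sum I J"
  then obtain f g f' g' where fg: "x = f + g" "y = f' + g'" "f \<in> I" "g \<in> J" "f' \<in> I" "g' \<in> J"
    unfolding ideal_sum_def by blast
  then have "x + y = (f + f') + (g + g')" by simp
  then show "x + y \<in> ideal_sum I J"
    using fg ideal.subspace_add[OF I] ideal.subspace_add[OF J] unfolding ideal_sum_def by blast
next
  fix c x assume "x \<in> ideal_sum I J"
  then obtain f g where fg: "x = f + g" "f \<in> I" "g \<in> J" unfolding ideal_sum_def by blast
  then have "c * x = c * f + c * g" by (simp add: distrib_left)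
  then show "c * x \<in> ideal_sum I J"
    using fg ideal.subspace_scale[OF I] ideal.subspace_scale[OF J] unfolding ideal_sum_def by blast
qed

lemma subspace_ideal_colon:
  assumes "ideal.subspace I"
  shows "ideal.subspace (ideal_colon I J)"
  unfolding ideal.subspace_def ideal_colon_def
  using assms by (auto simp: ideal.subspace_0 ideal.subspace_add ideal.subspace_scale
      distrib_right mult.assoc)

lemma subspace_ideal_power: "ideal.subspace (ideal_power I m)"
  by (cases m) (auto simp: ideal_mult_def ideal_gen_eq_span ideal.subspace_UNIV)

lemma subspace_poly3_ideal:
  fixes I :: "'k::field poly3 set"
  shows "ideal.subspace I \<Longrightarrow> poly3.subspace I"
  unfolding poly3.subspace_def poly3_scale_def
  by (auto intro: ideal.subspace_0 ideal.subspace_add ideal.subspace_scale)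

definition hom_part :: "nat \<Rightarrow> 'k::field poly3 \<Rightarrow> 'k poly3" where
  "hom_part t f = (\<Sum>m | m \<in> Poly_Mapping.keys f \<and> mdeg m = t.
     Poly_Mapping.single m (Poly_Mapping.lookup f m))"

lemma lookup_hom_part:
  "Poly_Mapping.lookup (hom_part t f) m = (if mdeg m = t then Poly_Mapping.lookup f m else 0)"
  unfolding hom_part_def
  by (auto simp: lookup_sum lookup_single when_def sum.delta not_in_keys_iff_lookup_eq_zero)

lemma hom_part_in_forms: "hom_part t f \<in> forms t"
  by (simp add: forms_iff lookup_hom_part)

lemma hom_part_add: "hom_part t (f + g) = hom_part t f + hom_part t g"
  by (rule poly_mapping_eqI) (simp add: lookup_hom_part lookup_add)

lemma hom_part_zero: "hom_part t 0 = 0"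
  by (simp add: hom_part_def)

lemma hom_part_sum: "hom_part t (sum f A) = (\<Sum>a\<in>A. hom_part t (f a))"
  by (induction A rule: infinite_finite_induct) (simp_all add: hom_part_add hom_part_zero)

lemma hom_part_form: "f \<in> forms s \<Longrightarrow> hom_part t f = (if t = s then f else 0)"
  by (rule poly_mapping_eqI) (auto simp: lookup_hom_part forms_iff)

lemma sum_hom_parts: 
  obtains N where "\<And>M. N \<le> M \<Longrightarrow> f = (\<Sum>t<M. hom_part t f)"
proof -
  have "finite (mdeg ` Poly_Mapping.keys f)" by simp
  then obtain N where N: "\<And>t. t \<in> mdeg ` Poly_Mapping.keys f \<Longrightarrow> t < N"
    by (meson finite_nat_set_iff_bounded)
  have "f = (\<Sum>t<M. hom_part t f)" if "N \<le> M" for M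
  proof (rule poly_mapping_eqI)
    fix m
    have "mdeg m < M" if "Poly_Mapping.lookup f m \<noteq> 0"
      using N[of "mdeg m"] that \<open>N \<le> M\<close> by (auto simp: in_keys_iff intro!: less_le_trans)
    then show "Poly_Mapping.lookup f m = Poly_Mapping.lookup (\<Sum>t<M. hom_part t f) m"
      by (cases "Poly_Mapping.lookup f m = 0") (simp_all add: lookup_sum lookup_hom_part)
  qed
  then show ?thesis by (rule that)
qed

lemma hom_part_mult_form:
  assumes g: "g \<in> forms s"
  shows "hom_part n (f * g) = (if s \<le> n then hom_part (n - s) f * g else 0)"
proof -
  obtain N where N: "\<And>M. N \<le> M \<Longrightarrow> f = (\<Sum>t<M. hom_part t f)" using sum_hom_parts by blast
  define M where "M = Suc n + N"
  have "n < M" by (simp add: M_def)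
  have "f = (\<Sum>t<M. hom_part t f)" by (rule N) (simp add: M_def)
  then have "f * g = (\<Sum>t<M. hom_part t f * g)" by (metis sum_distrib_right)
  then have "hom_part n (f * g) = (\<Sum>t<M. hom_part n (hom_part t f * g))"
    by (metis hom_part_sum)
  also have "\<dots> = (\<Sum>t<M. if t + s = n then hom_part t f * g else 0)"
    by (intro sum.cong refl) (auto simp: hom_part_form[OF forms_mult[OF hom_part_in_forms g]])
  also have "\<dots> = (\<Sum>t<M. if t = n - s then if s \<le> n then hom_part t f * g else 0 else 0)"
    by (intro sum.cong refl) auto
  also have "\<dots> = (if s \<le> n then hom_part (n - s) f * g else 0)"
    using \<open>n < M\<close> by (auto simp: sum.delta)
  finally show ?thesis .
qed

definition homogeneous :: "'k::field poly3 set \<Rightarrow> bool" where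
  "homogeneous I \<longleftrightarrow> ideal.subspace I \<and> (\<forall>f\<in>I. \<forall>t. hom_part t f \<in> I)"

lemma homogeneous_span:
  assumes S: "\<And>f. f \<in> S \<Longrightarrow> \<exists>d. f \<in> forms d"
  shows "homogeneous (ideal_gen S)"
proof -
  have "hom_part t f \<in> ideal.span S" if "f \<in> ideal.span S" for f t
    using that
  proof (induction rule: ideal.span_induct_alt)
    case base
    show ?case by (simp add: hom_part_zero ideal.span_zero)
  next
    case (step c g f)
    obtain d where "g \<in> forms d" using S step by blast
    then have "hom_part t (c * g) \<in> ideal.span S"
      using step by (auto simp: hom_part_mult_form ideal.span_zero ideal.span_base intro!: ideal.span_scale)
    then show ?case using step by (simp add: hom_part_add ideal.span_add)
  qed
  then show ?thesis by (simp add: homogeneous_def ideal_gen_eq_span)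
qed

lemma homogeneous_mult:
  assumes I: "homogeneous I" and J: "homogeneous J"
  shows "homogeneous (ideal_mult I J)"
proof -
  define S where "S = {f * g | f g. f \<in> I \<and> g \<in> J}"
  have product: "hom_part t (f * g) \<in> ideal.span S" if "f \<in> I" "g \<in> J" for f g t
  proof -
    obtain N where N: "g = (\<Sum>s<N. hom_part s g)" using sum_hom_parts by blast
    then have "f * g = (\<Sum>s<N. f * hom_part s g)" by (metis sum_distrib_left)
    then have "hom_part t (f * g) = (\<Sum>s<N. hom_part t (f * hom_part s g))"
      by (metis hom_part_sum)
    moreover have "hom_part t (f * hom_part s g) \<in> ideal.span S" for s
    proof (cases "s \<le> t")
      case True
      have "hom_part (t - s) f * hom_part s g \<in> S"
        using that I J unfolding S_def homogeneous_def by blast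
      with True show ?thesis
        by (simp add: hom_part_mult_form[OF hom_part_in_forms] ideal.span_base)
    qed (simp add: hom_part_mult_form[OF hom_part_in_forms] ideal.span_zero)
    ultimately show ?thesis by (simp add: ideal.span_sum)
  qed
  have "hom_part t f \<in> ideal.span S" if "f \<in> ideal.span S" for f t
    using that
  proof (induction rule: ideal.span_induct_alt)
    case base
    show ?case by (simp add: hom_part_zero ideal.span_zero)
  next
    case (step c x f)
    then obtain a b where ab: "x = a * b" "a \<in> I" "b \<in> J" by (auto simp: S_def)
    have "c * a \<in> I" using I ab by (simp add: homogeneous_def ideal.subspace_scale)
    then have "hom_part t ((c * a) * b) \<in> ideal.span S" using ab product by blast
    then show ?case using step by (simp add: hom_part_add ideal.span_add ab mult.assoc)
  qed
  then show ?thesis by (simp add: homogeneous_def ideal_gen_eq_span ideal_mult_def S_def)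
qed

lemma homogeneous_UNIV: "homogeneous UNIV"
  by (simp add: homogeneous_def ideal.subspace_UNIV)

lemma homogeneous_power: "homogeneous I \<Longrightarrow> homogeneous (ideal_power I m)"
  by (induction m) (simp_all add: homogeneous_UNIV homogeneous_mult)

lemma homogeneous_fat_ideal: "homogeneous (fat_ideal Z)"
proof -
  have "homogeneous (ideal_power (point_ideal P) m)" for P :: "'a proj_plane" and m
    unfolding point_ideal_def by (intro homogeneous_power homogeneous_span) auto
  then show ?thesis
    unfolding fat_ideal_def homogeneous_def by (auto intro!: ideal.subspace_Inter)
qed

lemma homogeneous_colon_principal:
  assumes I: "homogeneous I" and L: "L \<in> forms 1"
  shows "homogeneous (ideal_colon I (ideal_gen {L}))"
proof -
  have "hom_part t f * L \<in> I" if "f * L \<in> I" for f t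
  proof -
    have "hom_part (Suc t) (f * L) \<in> I" using I that by (simp add: homogeneous_def)
    then show ?thesis by (simp add: hom_part_mult_form[OF L])
  qed
  then show ?thesis
    using I subspace_ideal_colon[of I "ideal_gen {L}"]
    by (auto simp: homogeneous_def ideal_colon_principal)
qed

lemma homogeneous_eqI:
  assumes I: "homogeneous I" and J: "homogeneous J"
    and eq: "\<And>t f. f \<in> forms t \<Longrightarrow> f \<in> I \<longleftrightarrow> f \<in> J"
  shows "I = J"
proof -
  have "f \<in> J" if f: "f \<in> I" and IJ: "homogeneous I" "homogeneous J"
    and eq: "\<And>t f. f \<in> forms t \<Longrightarrow> f \<in> I \<longleftrightarrow> f \<in> J" for f and I J :: "'a poly3 set"
  proof -
    obtain N where "f = (\<Sum>t<N. hom_part t f)" using sum_hom_parts by blast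
    moreover have "hom_part t f \<in> J" for t
      using f IJ(1) eq[OF hom_part_in_forms] by (simp add: homogeneous_def)
    ultimately show ?thesis
      using IJ(2) by (metis homogeneous_def ideal.subspace_sum)
  qed
  from this[OF _ I J] this[OF _ J I] eq show ?thesis by blast
qed

text \<open>Taking homogeneous parts in a representation \<open>g + h L\<close> makes the cofactor \<open>h\<close> a form. In degree
  zero no multiple of \<open>L\<close> survives.\<close>

lemma form_in_ideal_sum_Suc:
  assumes I: "homogeneous I" and L: "L \<in> forms 1"
    and f: "f \<in> forms (Suc t)" "f \<in> ideal_sum I (ideal_gen {L})"
  obtains g h where "f = g + h * L" "g \<in> I" "h \<in> forms t"
proof -
  obtain g h where gh: "f = g + h * L" "g \<in> I"
    using f(2) by (auto simp: ideal_sum_def ideal_gen_singleton)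
  have "f = hom_part (Suc t) f" using f(1) by (simp add: hom_part_form)
  also have "\<dots> = hom_part (Suc t) g + hom_part t h * L"
    by (simp add: gh hom_part_add hom_part_mult_form[OF L])
  finally show ?thesis
    using that[of "hom_part (Suc t) g" "hom_part t h"] I gh(2)
    by (auto simp: homogeneous_def hom_part_in_forms)
qed

lemma form_in_ideal_sum_0:
  assumes I: "homogeneous I" and L: "L \<in> forms 1"
    and f: "f \<in> forms 0" "f \<in> ideal_sum I (ideal_gen {L})"
  shows "f \<in> I"
proof -
  obtain g h where gh: "f = g + h * L" "g \<in> I"
    using f(2) by (auto simp: ideal_sum_def ideal_gen_singleton)
  have "f = hom_part 0 f" using f(1) by (simp add: hom_part_form)
  also have "\<dots> = hom_part 0 g"
    by (simp add: gh hom_part_add hom_part_mult_form[OF L])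
  finally show ?thesis using I gh(2) by (metis homogeneous_def)
qed

section \<open>Hilbert functions and a residual exact sequence\<close>

text \<open>Multiplication by \<open>L\<close> induces an exact sequence
  \<open>0 \<rightarrow> (R/(I : L))\<^sub>t \<rightarrow> (R/I)\<^sub>t\<^sub>+\<^sub>1 \<rightarrow> (R/(I + L))\<^sub>t\<^sub>+\<^sub>1 \<rightarrow> 0\<close>, so \<open>L\<close> times a basis of the
  first quotient and a basis of the third one form a basis of the middle one.\<close>

lemma subset_ideal_sum:
  assumes "ideal.subspace J"
  shows "I \<subseteq> ideal_sum I J"
  using ideal.subspace_0[OF assms] unfolding ideal_sum_def by force

lemma hilbert_function_Suc:
  assumes I: "homogeneous I" and L: "L \<in> forms 1"
  shows "hilbert_function I (Suc t) = hilbert_function (ideal_colon I (ideal_gen {L})) t +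
           hilbert_function (ideal_sum I (ideal_gen {L})) (Suc t)"
proof -
  let ?C = "ideal_colon I (ideal_gen {L})" and ?S = "ideal_sum I (ideal_gen {L})"
  have sub: "ideal.subspace I" "ideal.subspace ?C" "ideal.subspace ?S"
    using I by (auto simp: homogeneous_def ideal_gen_eq_span intro!: subspace_ideal_colon subspace_ideal_sum)
  interpret I: finite_quotient poly3_scale "forms (Suc t)" I
    by (intro finite_quotient_forms subspace_poly3_ideal sub)
  interpret C: finite_quotient poly3_scale "forms t" ?C
    by (intro finite_quotient_forms subspace_poly3_ideal sub)
  interpret S: finite_quotient poly3_scale "forms (Suc t)" ?S
    by (intro finite_quotient_forms subspace_poly3_ideal sub)
  obtain B where B: "finite B" "B \<subseteq> forms t" "indep_mod poly3_scale ?C B (\<lambda>b. b)"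
    "spans_mod poly3_scale (forms t) ?C B (\<lambda>b. b)" "quotient_dim poly3_scale (forms t) ?C = card B"
    by (rule C.obtain_basis)
  obtain D where D: "finite D" "D \<subseteq> forms (Suc t)" "indep_mod poly3_scale ?S D (\<lambda>b. b)"
    "spans_mod poly3_scale (forms (Suc t)) ?S D (\<lambda>b. b)"
    "quotient_dim poly3_scale (forms (Suc t)) ?S = card D"
    by (rule S.obtain_basis)
  define g where "g = case_sum (\<lambda>b. b * L) (\<lambda>d. d)"
  have sum_g: "(\<Sum>j\<in>B <+> D. poly3_scale (c j) (g j)) =
      (\<Sum>b\<in>B. poly3_scale (c (Inl b)) b) * L + (\<Sum>d\<in>D. poly3_scale (c (Inr d)) d)" for c
    using B(1) D(1) by (simp add: sum.Plus g_def sum_distrib_right poly3_scale_mult)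
  have in_C: "f \<in> ?C \<longleftrightarrow> f * L \<in> I" for f
    using ideal_colon_principal[OF sub(1)] by auto
  have "indep_mod poly3_scale I (B <+> D) g"
    unfolding indep_mod_def
  proof (intro allI impI)
    fix c assume c: "(\<Sum>j\<in>B <+> D. poly3_scale (c j) (g j)) \<in> I"
    let ?b = "\<Sum>b\<in>B. poly3_scale (c (Inl b)) b" and ?d = "\<Sum>d\<in>D. poly3_scale (c (Inr d)) d"
    have "?d = (?b * L + ?d) + (- ?b) * L" by simp
    then have "?d \<in> ?S"
      using c unfolding sum_g ideal_sum_def ideal_gen_singleton by blast
    then have d0: "\<forall>d\<in>D. c (Inr d) = 0"
      using D(3) unfolding indep_mod_def by (elim allE[of _ "\<lambda>d. c (Inr d)"]) simp
    then have "?b * L \<in> I" using c unfolding sum_g by simp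
    then have "?b \<in> ?C" by (simp add: in_C)
    then have "\<forall>b\<in>B. c (Inl b) = 0"
      using B(3) unfolding indep_mod_def by (elim allE[of _ "\<lambda>d. c (Inl d)"]) simp
    with d0 show "\<forall>j\<in>B <+> D. c j = 0" by auto
  qed
  moreover have "spans_mod poly3_scale (forms (Suc t)) I (B <+> D) g"
    unfolding spans_mod_def
  proof
    fix f :: "'a poly3" assume f: "f \<in> forms (Suc t)"
    obtain c where c: "f - (\<Sum>d\<in>D. poly3_scale (c d) d) \<in> ?S"
      using D(4) f unfolding spans_mod_def by blast
    have "f - (\<Sum>d\<in>D. poly3_scale (c d) d) \<in> forms (Suc t)"
      using f D(2) by (intro poly3.subspace_diff poly3.subspace_sum poly3.subspace_scale subspace_forms) auto
    with c obtain g1 h where gh: "f - (\<Sum>d\<in>D. poly3_scale (c d) d) = g1 + h * L" "g1 \<in> I" "h \<in> forms t"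
      using form_in_ideal_sum_Suc[OF I L] by blast
    obtain e where e: "h - (\<Sum>b\<in>B. poly3_scale (e b) b) \<in> ?C"
      using B(4) gh(3) unfolding spans_mod_def by blast
    have "f - (\<Sum>j\<in>B <+> D. poly3_scale (case_sum e c j) (g j))
        = g1 + (h - (\<Sum>b\<in>B. poly3_scale (e b) b)) * L"
      using gh(1) unfolding sum_g by (simp add: algebra_simps)
    also have "\<dots> \<in> I"
      using e gh(2) sub(1) by (intro ideal.subspace_add) (auto simp: in_C)
    finally show "\<exists>c. f - (\<Sum>j\<in>B <+> D. poly3_scale (c j) (g j)) \<in> I" by blast
  qed
  moreover have "g j \<in> forms (Suc t)" if "j \<in> B <+> D" for j
    using that B(2) D(2) forms_mult[OF _ L, of _ t] by (auto simp: g_def)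
  ultimately have "quotient_dim poly3_scale (forms (Suc t)) I = card (B <+> D)"
    using B(1) D(1) by (intro I.quotient_dim_eq_card) auto
  then show ?thesis
    using B(1,5) D(1,5) by (simp add: hilbert_function_def card_Plus)
qed

lemma hilbert_function_0:
  assumes I: "homogeneous I" and L: "L \<in> forms 1"
  shows "hilbert_function I 0 = hilbert_function (ideal_sum I (ideal_gen {L})) 0"
proof -
  let ?S = "ideal_sum I (ideal_gen {L})"
  have sub: "ideal.subspace I" "ideal.subspace ?S"
    using I by (auto simp: homogeneous_def ideal_gen_eq_span intro!: subspace_ideal_sum)
  interpret I: finite_quotient poly3_scale "forms 0" I
    by (intro finite_quotient_forms subspace_poly3_ideal sub)
  interpret S: finite_quotient poly3_scale "forms 0" ?S
    by (intro finite_quotient_forms subspace_poly3_ideal sub)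
  obtain D where D: "finite D" "D \<subseteq> forms 0" "indep_mod poly3_scale ?S D (\<lambda>b. b)"
    "spans_mod poly3_scale (forms 0) ?S D (\<lambda>b. b)"
    "quotient_dim poly3_scale (forms 0) ?S = card D"
    by (rule S.obtain_basis)
  have "I \<subseteq> ?S" by (intro subset_ideal_sum) (simp add: ideal_gen_eq_span)
  then have "indep_mod poly3_scale I D (\<lambda>b. b)"
    using D(3) unfolding indep_mod_def by blast
  moreover have "spans_mod poly3_scale (forms 0) I D (\<lambda>b. b)"
    unfolding spans_mod_def
  proof
    fix f :: "'a poly3" assume f: "f \<in> forms 0"
    obtain c where c: "f - (\<Sum>d\<in>D. poly3_scale (c d) d) \<in> ?S"
      using D(4) f unfolding spans_mod_def by blast
    have "f - (\<Sum>d\<in>D. poly3_scale (c d) d) \<in> forms 0"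
      using f D(2) by (intro poly3.subspace_diff poly3.subspace_sum poly3.subspace_scale subspace_forms) auto
    then show "\<exists>c. f - (\<Sum>d\<in>D. poly3_scale (c d) d) \<in> I"
      using form_in_ideal_sum_0[OF I L] c by blast
  qed
  ultimately have "quotient_dim poly3_scale (forms 0) I = card D"
    using D(1,2) by (intro I.quotient_dim_eq_card) auto
  then show ?thesis using D(5) by (simp add: hilbert_function_def)
qed

section \<open>Powers of the ideal of a point\<close>

lemma rep_proj_plane:
  "rep_proj_plane P \<noteq> 0" "abs_proj_plane (rep_proj_plane P) = P"
  using Quotient3_rep_reflp[OF Quotient3_proj_plane, of P] Quotient3_abs_rep[OF Quotient3_proj_plane, of P]
  by (auto simp: proj_rel_def)

lemma abs_proj_plane_eq_iff:
  assumes "v \<noteq> 0" "w \<noteq> 0"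
  shows "abs_proj_plane v = abs_proj_plane w \<longleftrightarrow> (\<exists>c. c \<noteq> 0 \<and> w = c *s v)"
proof -
  have refl: "proj_rel x x" if "x \<noteq> 0" for x :: "'a ^ 3"
    using that by (auto simp: proj_rel_def intro!: exI[of _ 1])
  show ?thesis
    using Quotient3_rel[OF Quotient3_proj_plane, of v w] refl[OF assms(1)] refl[OF assms(2)] assms
    by (auto simp: proj_rel_def)
qed

lemma vanishes_at_imp: "vanishes_at f P \<Longrightarrow> poly3_eval f (rep_proj_plane P) = 0"
  using rep_proj_plane[of P] by (auto simp: vanishes_at_def)

lemma vanishes_at_iff:
  assumes "f \<in> forms t"
  shows "vanishes_at f P \<longleftrightarrow> poly3_eval f (rep_proj_plane P) = 0"
proof
  assume zero: "poly3_eval f (rep_proj_plane P) = 0"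
  show "vanishes_at f P"
    unfolding vanishes_at_def
  proof (intro allI impI)
    fix v assume v: "v \<noteq> 0 \<and> abs_proj_plane v = P"
    then obtain c where "v = c *s rep_proj_plane P"
      using abs_proj_plane_eq_iff[of "rep_proj_plane P" v] rep_proj_plane[of P] by auto
    then show "poly3_eval f v = 0" using zero by (simp add: eval_form_scale[OF assms])
  qed
qed (rule vanishes_at_imp)

context coefficient_hom
begin

lemma dvd_subst_ideal_gen:
  assumes "\<And>f. f \<in> S \<Longrightarrow> q dvd subst h x f" "f \<in> ideal_gen S"
  shows "q dvd subst h x f"
  using assms(2) unfolding ideal_gen_eq_span
  by (induction rule: ideal.span_induct_alt) (simp_all add: subst_zero subst_add subst_mult assms(1))

lemma power_dvd_subst_ideal_power:
  assumes "\<And>f. f \<in> I \<Longrightarrow> q dvd subst h x f" "f \<in> ideal_power I m"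
  shows "q ^ m dvd subst h x f"
  using assms(2)
proof (induction m arbitrary: f)
  case (Suc m)
  have "q ^ Suc m dvd subst h x g" if "g \<in> {f * g | f g. f \<in> I \<and> g \<in> ideal_power I m}" for g
    using that Suc.IH assms(1) by (auto simp: subst_mult intro!: mult_dvd_mono)
  moreover have "f \<in> ideal_gen {f * g | f g. f \<in> I \<and> g \<in> ideal_power I m}"
    using Suc.prems by (simp add: ideal_mult_def)
  ultimately show ?case by (rule dvd_subst_ideal_gen)
qed simp

end

lemma mult_in_ideal_power_Suc: "f \<in> I \<Longrightarrow> g \<in> ideal_power I m \<Longrightarrow> f * g \<in> ideal_power I (Suc m)"
  by (auto simp: ideal_mult_def ideal_gen_eq_span intro!: ideal.span_base)

lemma ideal_power_antimono:
  assumes "m \<le> n"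
  shows "ideal_power I n \<subseteq> ideal_power I m"
  using assms
proof (induction n rule: dec_induct)
  case (step n)
  have "{f * g | f g. f \<in> I \<and> g \<in> ideal_power I n} \<subseteq> ideal_power I n"
    using ideal.subspace_scale[OF subspace_ideal_power] by blast
  then have "ideal_power I (Suc n) \<subseteq> ideal_power I n"
    by (simp add: ideal_mult_def ideal_gen_eq_span ideal.span_minimal subspace_ideal_power)
  with step show ?case by blast
qed simp

lemma power_in_ideal_power:
  assumes "f \<in> I" "g \<in> ideal_power I m"
  shows "f ^ n * g \<in> ideal_power I (n + m)"
proof (induction n)
  case (Suc n)
  then show ?case
    using mult_in_ideal_power_Suc[OF assms(1) Suc] by (simp add: mult.assoc)
qed (simp add: assms)

text \<open>Along the pencil of lines the coordinate forms become \<open>1\<close>, \<open>s\<close> and \<open>s z\<close>, so the monomial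
  with exponents \<open>a\<close> and \<open>b\<close> becomes \<open>s\<^sup>a\<^sup>+\<^sup>b z\<^sup>b\<close>. These are linearly independent: the expansion
  determines the coefficients of the form.\<close>

lemma local_expansion_coefficients:
  assumes frame: "dual_frame y u" and f: "f \<in> forms t"
  obtains c where "f = (\<Sum>p\<in>exponents t. poly3_scale (c p) (frame_monomial y t p))"
    "\<And>r b. coeff (coeff (local_expansion (u 1) (u 2) (u 3) f) r) b =
      (if b \<le> r \<and> r \<le> t then c (r - b, b) else 0)"
proof -
  let ?F = "local_expansion (u 1) (u 2) (u 3)"
  obtain c where c: "f = (\<Sum>p\<in>exponents t. poly3_scale (c p) (frame_monomial y t p))"
    using forms_frame_expand[OF frame f] by blast
  have y: "y i \<in> forms 1" "poly3_eval (y i) (u j) = (if i = j then 1 else 0)" for i j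
    using frame by (auto simp: dual_frame_def)
  have F_y: "?F (y 1) = 1" "?F (y 2) = [:0, 1:]" "?F (y 3) = [:0, [:0, 1:]:]"
    by (simp_all add: local_expansion_linear[OF y(1)] y(2) one_pCons)
  have "?F (frame_monomial y t p) = monom (monom 1 (snd p)) (fst p + snd p)" for p
  proof -
    have "?F (frame_monomial y t p) = ?F (y 1) ^ (t - fst p - snd p) * ?F (y 2) ^ fst p * ?F (y 3) ^ snd p"
      by (simp add: frame_monomial_def local_expansion_def expn.subst_mult expn.subst_power)
    also have "[:0, [:0, 1::'a:]:] = monom (monom 1 1) 1" "[:0, 1 :: 'a poly:] = monom 1 1"
      by (simp_all add: monom_altdef)
    ultimately show ?thesis by (simp add: F_y monom_power mult_monom)
  qed
  then have F_f: "?F f = (\<Sum>p\<in>exponents t. smult [:c p:] (monom (monom 1 (snd p)) (fst p + snd p)))"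
    by (subst c) (simp add: local_expansion_def expn.subst_sum expn.subst_scale)
  have "coeff (coeff (?F f) r) b = (if b \<le> r \<and> r \<le> t then c (r - b, b) else 0)" for r b
  proof -
    have "coeff (coeff (?F f) r) b = (\<Sum>p\<in>exponents t. if p = (r - b, b) \<and> b \<le> r then c p else 0)"
      unfolding F_f coeff_sum by (intro sum.cong) (auto simp: prod_eq_iff)
    also have "\<dots> = (if b \<le> r then \<Sum>p\<in>exponents t. if p = (r - b, b) then c p else 0 else 0)"
      by simp
    also have "\<dots> = (if b \<le> r \<and> r \<le> t then c (r - b, b) else 0)"
      by (subst sum.delta[OF finite_exponents]) (auto simp: exponents_def)
    finally show ?thesis .
  qed
  with c that show ?thesis by blast
qed

lemma X_power_dvd_iff: "[:0, 1:] ^ m dvd p \<longleftrightarrow> (\<forall>k<m. coeff p k = 0)" for p :: "'a::idom poly"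
  using monom_1_dvd_iff'[of m p] by (simp add: monom_altdef)

text \<open>The generators of the ideal of \<open>P\<close> vanish at \<open>P\<close>, so their expansions are divisible by \<open>s\<close>.
  Conversely, divisibility of the expansion by \<open>s\<^sup>m\<close> kills the coefficients of all monomials of degree
  less than \<open>m\<close> in the two coordinate forms that vanish at \<open>P\<close>, and the other monomials visibly lie in the
  \<open>m\<close>-th power.\<close>

lemma form_in_point_ideal_power_iff:
  assumes frame: "dual_frame y u" and u: "u 1 = rep_proj_plane P" and f: "f \<in> forms t"
  shows "f \<in> ideal_power (point_ideal P) m \<longleftrightarrow>
    [:0, 1:] ^ m dvd local_expansion (u 1) (u 2) (u 3) f"
proof
  have "[:0, 1:] dvd local_expansion (u 1) (u 2) (u 3) g" if "g \<in> point_ideal P" for g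
    using that unfolding point_ideal_def local_expansion_def
  proof (rule expn.dvd_subst_ideal_gen[rotated])
    fix g :: "'a poly3" assume "g \<in> {f. (\<exists>d. f \<in> forms d) \<and> vanishes_at f P}"
    then have "poly (local_expansion (u 1) (u 2) (u 3) g) 0 = 0"
      using vanishes_at_imp[of g P] by (simp add: poly_0_coeff_0 coeff_0_local_expansion u)
    then show "[:0, 1:] dvd subst (\<lambda>c. [:[:c:]:]) (\<lambda>q. [:[:u 1 $ q:], [:u 2 $ q, u 3 $ q:]:]) g"
      by (simp add: poly_eq_0_iff_dvd local_expansion_def)
  qed
  moreover assume "f \<in> ideal_power (point_ideal P) m"
  ultimately show "[:0, 1:] ^ m dvd local_expansion (u 1) (u 2) (u 3) f"
    unfolding local_expansion_def by (rule expn.power_dvd_subst_ideal_power)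
next
  assume dvd: "[:0, 1:] ^ m dvd local_expansion (u 1) (u 2) (u 3) f"
  obtain c where c: "f = (\<Sum>p\<in>exponents t. poly3_scale (c p) (frame_monomial y t p))"
    and coeffs: "\<And>r b. coeff (coeff (local_expansion (u 1) (u 2) (u 3) f) r) b
        = (if b \<le> r \<and> r \<le> t then c (r - b, b) else 0)"
    using local_expansion_coefficients[OF frame f] by blast
  have y: "y i \<in> point_ideal P" if "i \<noteq> 1" for i
    unfolding point_ideal_def ideal_gen_eq_span
    using frame that vanishes_at_iff[of "y i" 1 P]
    by (intro ideal.span_base) (auto simp: dual_frame_def u[symmetric])
  have "poly3_scale (c p) (frame_monomial y t p) \<in> ideal_power (point_ideal P) m" if "p \<in> exponents t" for p
  proof (cases "fst p + snd p < m")
    case True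
    then have "coeff (local_expansion (u 1) (u 2) (u 3) f) (fst p + snd p) = 0"
      using dvd by (simp add: X_power_dvd_iff)
    then have "c p = 0"
      using coeffs[of "fst p + snd p" "snd p"] that by (simp add: exponents_def case_prod_beta)
    then show ?thesis by (simp add: ideal.subspace_0 subspace_ideal_power)
  next
    case False
    have "y 2 ^ fst p * (y 3 ^ snd p * 1) \<in> ideal_power (point_ideal P) (fst p + (snd p + 0))"
      by (intro power_in_ideal_power y) simp_all
    then have "y 2 ^ fst p * y 3 ^ snd p \<in> ideal_power (point_ideal P) m"
      using False ideal_power_antimono[of m "fst p + snd p" "point_ideal P"] by auto
    from ideal.subspace_scale[OF subspace_ideal_power this,
        of "Poly_Mapping.single 0 (c p) * y 1 ^ (t - fst p - snd p)"]
    show ?thesis by (simp add: poly3_scale_def frame_monomial_def mult.assoc)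
  qed
  then show "f \<in> ideal_power (point_ideal P) m"
    by (subst c) (intro ideal.subspace_sum subspace_ideal_power)
qed

text \<open>Locally at \<open>P\<close> a line through \<open>P\<close> has order exactly one, any other line is a unit.\<close>

lemma mult_linear_in_point_ideal_power_iff:
  fixes f L :: "'k::field poly3"
  assumes L: "linear_form L" and f: "f \<in> forms t"
  shows "f * L \<in> ideal_power (point_ideal P) m \<longleftrightarrow>
    f \<in> ideal_power (point_ideal P) (m - (if vanishes_at L P then 1 else 0))"
proof -
  obtain y u where frame: "dual_frame y u" and u: "u 1 = rep_proj_plane P"
    using dual_frame_at[OF rep_proj_plane(1)] by blast
  let ?F = "local_expansion (u 1) (u 2) (u 3)"
  have L1: "L \<in> forms 1" using L by (simp add: linear_form_def)
  have F_mult: "?F (f * L) = ?F f * ?F L"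
    by (simp add: local_expansion_def expn.subst_mult)
  have F_L: "?F L = [:[:poly3_eval L (u 1):], [:poly3_eval L (u 2), poly3_eval L (u 3):]:]"
    by (rule local_expansion_linear[OF L1])
  have van: "vanishes_at L P \<longleftrightarrow> poly3_eval L (u 1) = 0"
    using vanishes_at_iff[OF L1] u by simp
  have "[:0, 1:] ^ m dvd ?F f * ?F L \<longleftrightarrow> [:0, 1:] ^ (m - (if vanishes_at L P then 1 else 0)) dvd ?F f"
  proof (cases "vanishes_at L P")
    case True
    define s where "s = [:poly3_eval L (u 2), poly3_eval L (u 3):]"
    have "s \<noteq> 0"
    proof
      assume "s = 0"
      then have "L = 0"
        using dual_frame_expand[OF frame L1] True van by (simp add: s_def sum_3)
      then show False using L by (simp add: linear_form_def)
    qed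
    have F_L': "?F f * ?F L = [:0, 1:] * smult s (?F f)"
      using True van by (simp add: F_L s_def)
    show ?thesis
    proof (cases m)
      case (Suc k)
      have "[:0, 1:] ^ m dvd ?F f * ?F L \<longleftrightarrow> [:0, 1:] * [:0, 1:] ^ k dvd [:0, 1:] * smult s (?F f)"
        by (simp add: F_L' Suc)
      also have "\<dots> \<longleftrightarrow> [:0, 1:] ^ k dvd smult s (?F f)"
        by (rule dvd_mult_cancel_left[THEN trans]) simp
      also have "\<dots> \<longleftrightarrow> [:0, 1:] ^ k dvd ?F f"
        using \<open>s \<noteq> 0\<close> by (simp add: X_power_dvd_iff)
      finally show ?thesis using True Suc by simp
    qed simp
  next
    case False
    have "order 0 (?F L) = 0"
      using False van by (intro order_0I) (simp add: F_L)
    moreover have "?F L \<noteq> 0" using False van by (simp add: F_L)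
    ultimately show ?thesis
      using False order_divides[of 0 m "?F f * ?F L"] order_divides[of 0 m "?F f"]
      by (auto simp: order_mult)
  qed
  then show ?thesis
    unfolding form_in_point_ideal_power_iff[OF frame u f] F_mult
      form_in_point_ideal_power_iff[OF frame u forms_mult[OF f L1]] .
qed

section \<open>Residuals and degrees of fat point schemes\<close>

lemma mem_fat_ideal_iff: "f \<in> fat_ideal Z \<longleftrightarrow> (\<forall>P. f \<in> ideal_power (point_ideal P) (count Z P))"
proof -
  have "f \<in> ideal_power (point_ideal P) (count Z P)" if "P \<notin> set_mset Z" for P
    using that by (simp add: not_in_iff)
  then show ?thesis unfolding fat_ideal_def by blast
qed

definition residual :: "'p multiset \<Rightarrow> 'p set \<Rightarrow> 'p multiset" where
  "residual Z l = Z - mset_set (set_mset Z \<inter> l)"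

lemma count_residual: "count (residual Z l) X = count Z X - (if X \<in> l then 1 else 0)"
  by (cases "X \<in># Z") (auto simp: residual_def count_mset_set' not_in_iff)

text \<open>Both sides are homogeneous, so it suffices to compare forms, and for these the condition can be
  checked at one point at a time.\<close>

lemma ideal_colon_fat_ideal:
  assumes L: "linear_form L"
  shows "ideal_colon (fat_ideal Z) (ideal_gen {L}) = fat_ideal (residual Z (zero_locus L))"
proof -
  have L1: "L \<in> forms 1" using L by (simp add: linear_form_def)
  have sub: "ideal.subspace (fat_ideal Z)" using homogeneous_fat_ideal by (auto simp: homogeneous_def)
  show ?thesis
  proof (rule homogeneous_eqI[OF homogeneous_colon_principal[OF homogeneous_fat_ideal L1] homogeneous_fat_ideal])
    fix t and f :: "'a poly3" assume f: "f \<in> forms t"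
    show "f \<in> ideal_colon (fat_ideal Z) (ideal_gen {L}) \<longleftrightarrow> f \<in> fat_ideal (residual Z (zero_locus L))"
      by (simp add: ideal_colon_principal[OF sub] mem_fat_ideal_iff count_residual zero_locus_def
          mult_linear_in_point_ideal_power_iff[OF L f])
  qed
qed

definition fat_degree :: "'p multiset \<Rightarrow> nat" where
  "fat_degree Z = (\<Sum>P\<in>set_mset Z. Suc (count Z P) choose 2)"

lemma fat_degree_superset:
  assumes "finite S" "set_mset Z \<subseteq> S"
  shows "fat_degree Z = (\<Sum>P\<in>S. Suc (count Z P) choose 2)"
  unfolding fat_degree_def using assms by (intro sum.mono_neutral_left) (auto simp: not_in_iff numeral_2_eq_2)

lemma size_filter_superset:
  assumes "finite S" "set_mset Z \<subseteq> S"
  shows "size {#X \<in># Z. X \<in> l#} = (\<Sum>X\<in>S. if X \<in> l then count Z X else 0)"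
proof -
  have "size {#X \<in># Z. X \<in> l#} = (\<Sum>X\<in>S. count {#X \<in># Z. X \<in> l#} X)"
    unfolding size_multiset_overloaded_eq using assms
    by (intro sum.mono_neutral_left) (auto simp: not_in_iff)
  then show ?thesis by (simp add: if_distrib cong: if_cong)
qed

lemma fat_degree_residual: "fat_degree Z = size {#X \<in># Z. X \<in> l#} + fat_degree (residual Z l)"
proof -
  have sub: "set_mset (residual Z l) \<subseteq> set_mset Z" by (auto simp: residual_def dest: in_diffD)
  have step: "Suc m choose 2 = m + (Suc (m - 1) choose 2)" for m
    by (cases m) (simp_all add: numeral_2_eq_2)
  have "Suc (count Z P) choose 2 =
      (if P \<in> l then count Z P else 0) + (Suc (count (residual Z l) P) choose 2)" for P
    using step[of "count Z P"] by (simp add: count_residual)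
  then show ?thesis
    unfolding fat_degree_def[of Z] fat_degree_superset[OF finite_set_mset sub]
      size_filter_superset[OF finite_set_mset order_refl] sum.distrib[symmetric]
    by simp
qed

text \<open>At a point of multiplicity \<open>m\<close> the conditions are the vanishing of the coefficients of
  \<open>s\<^sup>r z\<^sup>b\<close> with \<open>b \<le> r < m\<close> in the local expansion.\<close>

lemma hilbert_function_le_fat_degree:
  fixes Z :: "'k::field proj_plane multiset"
  shows "hilbert_function (fat_ideal Z) t \<le> fat_degree Z"
proof -
  have "\<exists>u. \<exists>y. dual_frame y u \<and> u 1 = rep_proj_plane P" for P :: "'k proj_plane"
    using dual_frame_at[OF rep_proj_plane(1)] by blast
  then obtain u where u: "\<And>P :: 'k proj_plane. \<exists>y. dual_frame y (u P) \<and> u P 1 = rep_proj_plane P"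
    by metis
  define F where "F P = local_expansion (u P 1) (u P 2) (u P 3)" for P
  define J where "J = (SIGMA P:set_mset Z. SIGMA r:{..<count Z P}. {..r})"
  define \<phi> where "\<phi> = (\<lambda>(P, r, b) f. coeff (coeff (F P f) r) b)"
  interpret finite_quotient poly3_scale "forms t" "fat_ideal Z"
    using homogeneous_fat_ideal by (intro finite_quotient_forms subspace_poly3_ideal) (auto simp: homogeneous_def)
  have "quotient_dim poly3_scale (forms t) (fat_ideal Z) \<le> card J"
  proof (rule quotient_dim_le_functionals[of J \<phi>])
    show "finite J" by (simp add: J_def)
  next
    fix j and f g :: "'k poly3" and c
    show "\<phi> j (f + g) = \<phi> j f + \<phi> j g"
      by (simp add: \<phi>_def F_def local_expansion_def expn.subst_add split: prod.split)
    show "\<phi> j (poly3_scale c f) = c * \<phi> j f"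
      by (simp add: \<phi>_def F_def local_expansion_def expn.subst_scale split: prod.split)
  next
    fix f :: "'k poly3" assume f: "f \<in> forms t" and zero: "\<And>j. j \<in> J \<Longrightarrow> \<phi> j f = 0"
    have "f \<in> ideal_power (point_ideal P) (count Z P)" if P: "P \<in> set_mset Z" for P
    proof -
      obtain y where y: "dual_frame y (u P)" "u P 1 = rep_proj_plane P" using u by blast
      obtain c where c: "\<And>r b. coeff (coeff (F P f) r) b = (if b \<le> r \<and> r \<le> t then c (r - b, b) else 0)"
        using local_expansion_coefficients[OF y(1) f] unfolding F_def by metis
      have "coeff (F P f) r = 0" if "r < count Z P" for r
      proof (rule poly_eqI)
        fix b
        show "coeff (coeff (F P f) r) b = coeff 0 b"
        proof (cases "b \<le> r")
          case True
          then have "(P, r, b) \<in> J" using P that by (simp add: J_def)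
          then show ?thesis using zero by (fastforce simp: \<phi>_def)
        qed (simp add: c)
      qed
      then show ?thesis
        unfolding form_in_point_ideal_power_iff[OF y f] F_def[symmetric]
        by (simp add: X_power_dvd_iff)
    qed
    then show "f \<in> fat_ideal Z" by (simp add: fat_ideal_def)
  qed
  also have "card J = fat_degree Z"
  proof -
    have "(\<Sum>r<m. Suc r) = Suc m choose 2" for m
      by (induction m) (simp_all add: numeral_2_eq_2)
    then show ?thesis by (simp add: J_def fat_degree_def)
  qed
  finally show ?thesis by (simp add: hilbert_function_def)
qed

section \<open>Restriction to a line\<close>

lemma eval_linear:
  assumes "L \<in> forms 1"
  shows "poly3_eval L (v + w) = poly3_eval L v + poly3_eval L w"
    and "poly3_eval L (v - w) = poly3_eval L v - poly3_eval L w"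
    and "poly3_eval L (c *s v) = c * poly3_eval L v"
    and "poly3_eval L 0 = 0"
  unfolding poly3_eval_subst eval.subst_linear[OF assms]
  by (simp_all add: algebra_simps sum.distrib sum_subtractf sum_distrib_left)

lemma dual_frame_coordinates:
  assumes "dual_frame y u"
  shows "v = (\<Sum>i\<in>UNIV. poly3_eval (y i) v *s u i)"
proof -
  have "v $ q = (\<Sum>i\<in>UNIV. poly3_eval (y i) v * u i $ q)" for q
  proof -
    have "v $ q = poly3_eval (var q) v" by (simp add: poly3_eval_subst eval.subst_var)
    also have "var q = (\<Sum>i\<in>UNIV. poly3_scale (u i $ q) (y i))"
      using assms by (simp add: dual_frame_def)
    finally show ?thesis
      by (simp add: poly3_eval_subst eval.subst_sum eval.subst_scale mult.commute)
  qed
  then show ?thesis by (simp add: vec_eq_iff)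
qed

text \<open>A frame whose first two vectors span a given line. The second vector will be the point at
  infinity of the affine parameter, so it has to avoid finitely many given points of the line; it is
  found in a family indexed by the infinite field.\<close>

lemma dual_frame_line:
  fixes L :: "'k::field_char_0 poly3"
  assumes L: "linear_form L" and S: "finite S"
  obtains y u where "dual_frame y u" "poly3_eval L (u 1) = 0" "poly3_eval L (u 2) = 0"
    "poly3_eval L (u 3) \<noteq> 0" "abs_proj_plane (u 2) \<notin> S"
proof -
  have L1: "L \<in> forms 1" and "L \<noteq> 0" using L by (auto simp: linear_form_def)
  have "(1 :: 'k ^ 3) \<noteq> 0" by simp
  then obtain y' u' where frame': "dual_frame y' (u' :: 3 \<Rightarrow> 'k ^ 3)"
    by (rule dual_frame_at)
  have "\<exists>i. poly3_eval L (u' i) \<noteq> 0"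
  proof (rule ccontr)
    assume "\<not> ?thesis"
    then show False using dual_frame_expand[OF frame' L1] \<open>L \<noteq> 0\<close> by simp
  qed
  then obtain z where z: "poly3_eval L z \<noteq> 0" by blast
  then have "z \<noteq> 0" using eval_linear(4)[OF L1] by auto
  then obtain y0 v where frame0: "dual_frame y0 v" "v 1 = z" by (rule dual_frame_at)
  have y0: "y0 i \<in> forms 1" "poly3_eval (y0 i) (v j) = (if i = j then 1 else 0)" for i j
    using frame0(1) by (auto simp: dual_frame_def)
  have y0z: "poly3_eval (y0 i) z = (if i = 1 then 1 else 0)" for i
    using y0(2)[of i 1] frame0(2) by simp
  note eval_y0 = eval_linear[OF y0(1)] y0(2) y0z
  define k where "k i = v i - (poly3_eval L (v i) / poly3_eval L z) *s z" for i
  have Lk: "poly3_eval L (k i) = 0" for i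
    using z by (simp add: k_def eval_linear[OF L1])
  \<comment> \<open>\<open>k i\<close> is the projection of \<open>v i\<close> to the kernel of \<open>L\<close> along \<open>z\<close>\<close>
  define w where "w c = k 3 + c *s k 2" for c
  have w_coords: "poly3_eval (y0 3) (w c) = 1" "poly3_eval (y0 2) (w c) = c" for c
    by (simp_all add: w_def k_def eval_y0)
  then have w_nz: "w c \<noteq> 0" for c
    using eval_linear(4)[OF y0(1), of 3] by (metis zero_neq_one)
  \<comment> \<open>the points \<open>w c\<close> of the line are distinct, so one of them is not in \<open>S\<close>\<close>
  have "inj (\<lambda>c. abs_proj_plane (w c))"
  proof (rule injI)
    fix c c' assume "abs_proj_plane (w c) = abs_proj_plane (w c')"
    then obtain e where e: "w c' = e *s w c" using abs_proj_plane_eq_iff[OF w_nz w_nz] by blast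
    then have "e = 1"
      using w_coords(1)[of c] w_coords(1)[of c'] by (simp add: eval_linear[OF y0(1)])
    then show "c = c'" using e w_coords(2)[of c] w_coords(2)[of c'] by simp
  qed
  then have "infinite (range (\<lambda>c. abs_proj_plane (w c)))"
    by (meson finite_imageD infinite_UNIV_char_0)
  then obtain c where c: "abs_proj_plane (w c) \<notin> S"
    using S by (meson finite_subset image_subsetI)
  define u where "u i = (if i = 1 then k 2 else if i = 2 then w c else z)" for i :: 3
  have u: "u 1 = k 2" "u 2 = w c" "u 3 = z" by (simp_all add: u_def)
  have "\<exists>y. dual_frame y u"
  proof (rule dual_frame_exists)
    fix a assume "(\<Sum>i\<in>UNIV. a i *s u i) = 0"
    then have eq: "a 1 *s k 2 + a 2 *s w c + a 3 *s z = 0" by (simp add: sum_3 u)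
    have "poly3_eval (y0 i) (a 1 *s k 2 + a 2 *s w c + a 3 *s z) = 0" for i
      by (simp add: eq eval_linear[OF y0(1)])
    from this[of 3] this[of 2] this[of 1] have "a 2 = 0" "a 1 = 0" "a 3 = 0"
      by (simp_all add: eval_y0 k_def w_def)
    then show "\<forall>i. a i = 0" by (simp add: forall_3)
  qed
  then obtain y where "dual_frame y u" by blast
  then show ?thesis
    using that[of y u] Lk z c by (simp add: u w_def eval_linear[OF L1])
qed

text \<open>The third coordinate of a frame adapted to the line is a multiple of \<open>L\<close>, so modulo \<open>L\<close> only the
  monomials in the first two coordinates remain.\<close>

lemma hilbert_function_mod_line_le:
  fixes L :: "'k::field_char_0 poly3"
  assumes L: "linear_form L" and I: "ideal.subspace I"
  shows "hilbert_function (ideal_sum I (ideal_gen {L})) t \<le> t + 1"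
proof -
  let ?S = "ideal_sum I (ideal_gen {L})"
  have L1: "L \<in> forms 1" using L by (simp add: linear_form_def)
  obtain y u where frame: "dual_frame y u" and u: "poly3_eval L (u 1) = 0" "poly3_eval L (u 2) = 0"
    "poly3_eval L (u 3) \<noteq> 0"
    using dual_frame_line[OF L finite.emptyI] by blast
  have L_y: "L = poly3_scale (poly3_eval L (u 3)) (y 3)"
    using dual_frame_expand[OF frame L1] u by (simp add: sum_3)
  have "y 3 = Poly_Mapping.single 0 (1 / poly3_eval L (u 3)) * L"
    by (subst L_y) (use u(3) in \<open>simp add: poly3_scale_def mult_single flip: mult.assoc\<close>)
  then have y3: "y 3 \<in> ideal_gen {L}" unfolding ideal_gen_singleton by blast
  have sub: "ideal.subspace (ideal_gen {L})" by (simp add: ideal_gen_eq_span)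
  interpret finite_quotient poly3_scale "forms t" ?S
    by (intro finite_quotient_forms subspace_poly3_ideal subspace_ideal_sum I sub)
  have "spans_mod poly3_scale (forms t) ?S {..t} (\<lambda>a. frame_monomial y t (a, 0))"
    unfolding spans_mod_def
  proof
    fix f :: "'k poly3" assume "f \<in> forms t"
    then obtain c where c: "f = (\<Sum>p\<in>exponents t. poly3_scale (c p) (frame_monomial y t p))"
      using forms_frame_expand[OF frame] by blast
    let ?T = "(\<lambda>a. (a, 0)) ` {..t}"
    have T: "?T \<subseteq> exponents t" by (auto simp: exponents_def)
    have "f = (\<Sum>p\<in>exponents t - ?T. poly3_scale (c p) (frame_monomial y t p)) +
        (\<Sum>p\<in>?T. poly3_scale (c p) (frame_monomial y t p))"
      unfolding c by (rule sum.subset_diff[OF T finite_exponents])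
    also have "(\<Sum>p\<in>?T. poly3_scale (c p) (frame_monomial y t p)) =
        (\<Sum>a\<le>t. poly3_scale (c (a, 0)) (frame_monomial y t (a, 0)))"
      by (subst sum.reindex) (auto simp: inj_on_def)
    finally have "f - (\<Sum>a\<le>t. poly3_scale (c (a, 0)) (frame_monomial y t (a, 0))) =
        (\<Sum>p\<in>exponents t - ?T. poly3_scale (c p) (frame_monomial y t p))" by simp
    also have "\<dots> \<in> ideal_gen {L}"
    proof (intro ideal.subspace_sum sub)
      fix p assume p: "p \<in> exponents t - ?T"
      then have "snd p \<noteq> 0" by (cases p) (auto simp: exponents_def)
      then obtain b where b: "snd p = Suc b" using not0_implies_Suc by blast
      have "poly3_scale (c p) (frame_monomial y t p) =
          (Poly_Mapping.single 0 (c p) * y 1 ^ (t - fst p - snd p) * y 2 ^ fst p * y 3 ^ b) * y 3"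
        by (simp add: poly3_scale_def frame_monomial_def b algebra_simps)
      then show "poly3_scale (c p) (frame_monomial y t p) \<in> ideal_gen {L}"
        using ideal.subspace_scale[OF sub y3] by metis
    qed
    finally have "f - (\<Sum>a\<le>t. poly3_scale (c (a, 0)) (frame_monomial y t (a, 0))) \<in> ideal_gen {L}" .
    moreover have "ideal_gen {L} \<subseteq> ?S"
      using ideal.subspace_0[OF I] unfolding ideal_sum_def by force
    ultimately show "\<exists>c. f - (\<Sum>a\<le>t. poly3_scale (c a) (frame_monomial y t (a, 0))) \<in> ?S"
      by (intro exI[of _ "\<lambda>a. c (a, 0)"]) blast
  qed
  then show ?thesis
    using quotient_dim_le[of "{..t}"] by (simp add: hilbert_function_def)
qed

lemma sum_multiplicities_le_degree:
  fixes p :: "'k::idom poly"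
  assumes "finite A" "p \<noteq> 0" "\<And>a. a \<in> A \<Longrightarrow> [:- a, 1:] ^ m a dvd p"
  shows "sum m A \<le> degree p"
proof -
  have "sum m A \<le> (\<Sum>a\<in>A. order a p)"
    using assms by (intro sum_mono) (simp add: order_divides)
  also have "\<dots> = (\<Sum>a\<in>A \<inter> {x. poly p x = 0}. order a p)"
    using assms by (intro sum.mono_neutral_right) (auto simp: order_root)
  also have "\<dots> \<le> (\<Sum>x | poly p x = 0. order x p)"
    using assms by (intro sum_mono2 poly_roots_finite) auto
  also have "\<dots> \<le> degree p" using assms(2) by (rule sum_order_le_degree)
  finally show ?thesis .
qed

text \<open>Restricted to the line, a form of the ideal of \<open>Z\<close> vanishes to order \<open>m\<close> at every point of
  multiplicity \<open>m\<close>. A nonzero combination of the monomials of low degree in the affine parameter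
  cannot have that many zeros.\<close>

lemma hilbert_function_mod_line_ge:
  fixes L :: "'k::field_char_0 poly3"
  assumes L: "linear_form L"
  shows "min (t + 1) (size {#X \<in># Z. X \<in> zero_locus L#})
    \<le> hilbert_function (ideal_sum (fat_ideal Z) (ideal_gen {L})) t"
proof -
  let ?S = "ideal_sum (fat_ideal Z) (ideal_gen {L})"
  define T where "T = set_mset Z \<inter> zero_locus L"
  have L1: "L \<in> forms 1" using L by (simp add: linear_form_def)
  obtain y u where frame: "dual_frame y u" and u: "poly3_eval L (u 1) = 0" "poly3_eval L (u 2) = 0"
    "poly3_eval L (u 3) \<noteq> 0" and avoid: "abs_proj_plane (u 2) \<notin> T"
    using dual_frame_line[OF L, of T] by (auto simp: T_def)
  have y: "y i \<in> forms 1" "poly3_eval (y i) (u j) = (if i = j then 1 else 0)" for i j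
    using frame by (auto simp: dual_frame_def)
  have "\<exists>s. u 1 + s *s u 2 \<noteq> 0 \<and> abs_proj_plane (u 1 + s *s u 2) = P" if P: "P \<in> T" for P
  proof -
    let ?v = "rep_proj_plane P"
    have "poly3_eval L ?v = 0"
      using P vanishes_at_imp by (auto simp: T_def zero_locus_def)
    moreover have "poly3_eval L ?v = poly3_eval L (u 3) * poly3_eval (y 3) ?v"
      using dual_frame_expand[OF frame L1] u
      by (metis (no_types, lifting) add_0 eval.subst_scale poly3.scale_zero_left poly3_eval_subst sum_3)
    ultimately have y3: "poly3_eval (y 3) ?v = 0" using u by simp
    define a b where "a = poly3_eval (y 1) ?v" and "b = poly3_eval (y 2) ?v"
    have v: "?v = a *s u 1 + b *s u 2"
      using dual_frame_coordinates[OF frame, of ?v] y3 by (simp add: sum_3 a_def b_def)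
    have "u 2 \<noteq> 0" using y(2)[of 2 2] eval_linear(4)[OF y(1)] by auto
    have "a \<noteq> 0"
    proof
      assume "a = 0"
      then have "?v = b *s u 2" using v by simp
      moreover from this have "b \<noteq> 0" using rep_proj_plane(1)[of P] by auto
      ultimately have "abs_proj_plane (u 2) = P"
        using abs_proj_plane_eq_iff[OF \<open>u 2 \<noteq> 0\<close> rep_proj_plane(1)] rep_proj_plane(2) by metis
      then show False using avoid P by simp
    qed
    then have v': "?v = a *s (u 1 + (b / a) *s u 2)" using v by (simp add: vec.scale_right_distrib)
    then have nz: "u 1 + (b / a) *s u 2 \<noteq> 0"
      using rep_proj_plane(1)[of P] by (metis vec.scale_zero_right)
    then have "abs_proj_plane (u 1 + (b / a) *s u 2) = P"
      using abs_proj_plane_eq_iff[OF nz rep_proj_plane(1)] rep_proj_plane(2) v' \<open>a \<noteq> 0\<close> by metis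
    with nz show ?thesis by blast
  qed
  then obtain s where s: "\<And>P. P \<in> T \<Longrightarrow> u 1 + s P *s u 2 \<noteq> 0"
    "\<And>P. P \<in> T \<Longrightarrow> abs_proj_plane (u 1 + s P *s u 2) = P" by metis
  have inj: "inj_on s T" using s(2) by (metis inj_onI)
  define \<rho> where "\<rho> = line_restrict (u 1) (u 2)"
  have "[:- s P, 1:] dvd \<rho> g" if P: "P \<in> T" and g: "g \<in> point_ideal P" for g P
    using g unfolding point_ideal_def \<rho>_def line_restrict_def
  proof (rule restr.dvd_subst_ideal_gen[rotated])
    fix f :: "'k poly3" assume "f \<in> {f. (\<exists>d. f \<in> forms d) \<and> vanishes_at f P}"
    then have "poly3_eval f (u 1 + s P *s u 2) = 0"
      using s[OF P] by (auto simp: vanishes_at_def)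
    then show "[:- s P, 1:] dvd subst (\<lambda>c. [:c:]) (\<lambda>q. [:u 1 $ q, u 2 $ q:]) f"
      by (simp add: poly_line_restrict[unfolded line_restrict_def] flip: poly_eq_0_iff_dvd)
  qed
  then have dvd: "[:- s P, 1:] ^ count Z P dvd \<rho> g" if "P \<in> T" "g \<in> fat_ideal Z" for P g
    using that restr.power_dvd_subst_ideal_power[of "point_ideal P" "[:- s P, 1:]" _ g "count Z P"]
    unfolding mem_fat_ideal_iff \<rho>_def line_restrict_def by blast
  define e where "e = size {#X \<in># Z. X \<in> zero_locus L#}"
  have e: "e = (\<Sum>P\<in>T. count Z P)"
    unfolding e_def size_filter_superset[OF finite_set_mset order_refl] T_def
    by (simp add: sum.inter_restrict)
  have \<rho>_y: "\<rho> (y 1) = 1" "\<rho> (y 2) = monom 1 1" "\<rho> L = 0"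
    by (simp_all add: \<rho>_def line_restrict_linear[OF y(1)] line_restrict_linear[OF L1] y(2) u
        one_pCons monom_altdef)
  define k where "k = min (t + 1) e"
  define g where "g b = y 1 ^ (t - b) * y 2 ^ b" for b
  have g_forms: "g b \<in> forms t" if "b < k" for b
    using that forms_mult[OF forms_power[OF y(1), where n = "t - b"] forms_power[OF y(1), where n = b]]
    by (simp add: g_def k_def)
  have \<rho>_g: "\<rho> (g b) = monom 1 b" for b
    using \<rho>_y unfolding \<rho>_def line_restrict_def
    by (simp add: g_def restr.subst_mult restr.subst_power monom_power)
  interpret finite_quotient poly3_scale "forms t" ?S
    using homogeneous_fat_ideal[of Z]
    by (intro finite_quotient_forms subspace_poly3_ideal subspace_ideal_sum)
      (auto simp: homogeneous_def ideal_gen_eq_span)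
  have "indep_mod poly3_scale ?S {..<k} g"
    unfolding indep_mod_def
  proof (intro allI impI)
    fix c assume "(\<Sum>b<k. poly3_scale (c b) (g b)) \<in> ?S"
    then obtain f h where fh: "(\<Sum>b<k. poly3_scale (c b) (g b)) = f + h * L" "f \<in> fat_ideal Z"
      by (auto simp: ideal_sum_def ideal_gen_singleton)
    define p where "p = (\<Sum>b<k. monom (c b) b)"
    have "p = (\<Sum>b<k. \<rho> (poly3_scale (c b) (g b)))"
      using \<rho>_g unfolding \<rho>_def line_restrict_def
      by (simp add: p_def restr.subst_scale smult_monom)
    also have "\<dots> = \<rho> f"
      using arg_cong[OF fh(1), of \<rho>] \<rho>_y(3)
      by (simp add: \<rho>_def line_restrict_def restr.subst_sum restr.subst_add restr.subst_mult)
    finally have p: "p = \<rho> f" .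
    have coeff_p: "coeff p r = (if r < k then c r else 0)" for r
      by (simp add: p_def coeff_sum sum.delta)
    have "p = 0"
    proof (rule ccontr)
      assume nz: "p \<noteq> 0"
      have "(\<Sum>a\<in>s ` T. count Z (the_inv_into T s a)) \<le> degree p"
      proof (rule sum_multiplicities_le_degree[OF _ nz])
        show "finite (s ` T)" by (simp add: T_def)
        fix a assume "a \<in> s ` T"
        then show "[:- a, 1:] ^ count Z (the_inv_into T s a) dvd p"
          using dvd fh(2) inj by (auto simp: the_inv_into_f_f p)
      qed
      moreover have "(\<Sum>a\<in>s ` T. count Z (the_inv_into T s a)) = e"
        unfolding e using inj by (simp add: sum.reindex the_inv_into_f_f)
      moreover have "degree p < k"
        using coeff_p[of "degree p"] nz by (auto split: if_splits)
      ultimately show False by (simp add: k_def)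
    qed
    then show "\<forall>b\<in>{..<k}. c b = 0" using coeff_p by (metis coeff_0 lessThan_iff)
  qed
  then have "card {..<k} \<le> quotient_dim poly3_scale (forms t) ?S"
    using g_forms by (intro quotient_dim_ge) auto
  then show ?thesis by (simp add: k_def e_def hilbert_function_def)
qed

lemma hilbert_function_fat_ideal_Suc:
  assumes "linear_form L"
  shows "hilbert_function (fat_ideal Z) (Suc t) = hilbert_function (fat_ideal (residual Z (zero_locus L))) t +
           hilbert_function (ideal_sum (fat_ideal Z) (ideal_gen {L})) (Suc t)"
  using hilbert_function_Suc[OF homogeneous_fat_ideal, of L Z t] assms ideal_colon_fat_ideal[OF assms, of Z]
  by (simp add: linear_form_def)

lemma line_through_point:
  obtains L :: "'k::field poly3" where "linear_form L" "P \<in> zero_locus L"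
proof -
  obtain y u where frame: "dual_frame y u" "u 1 = rep_proj_plane P"
    using dual_frame_at[OF rep_proj_plane(1)] by blast
  have y: "y 2 \<in> forms 1" "poly3_eval (y 2) (u 1) = 0" "poly3_eval (y 2) (u 2) = 1"
    using frame(1) by (auto simp: dual_frame_def)
  have "y 2 \<noteq> 0" using y(3) by (auto simp: poly3_eval_def)
  then show ?thesis
    using that[of "y 2"] y frame(2) vanishes_at_iff[OF y(1)] by (simp add: linear_form_def zero_locus_def)
qed

text \<open>Peeling off lines through the points of \<open>Z\<close> one after the other shows that in large degrees
  the conditions imposed by the points are independent.\<close>

lemma hilbert_function_fat_ideal_eventually:
  fixes Z :: "'k::field_char_0 proj_plane multiset"
  shows "\<forall>\<^sub>F t in sequentially. hilbert_function (fat_ideal Z) t = fat_degree Z"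
proof -
  have "\<forall>\<^sub>F t in sequentially. fat_degree Z \<le> hilbert_function (fat_ideal Z) t"
  proof (induction "size Z" arbitrary: Z rule: less_induct)
    case less
    show ?case
    proof (cases "Z = {#}")
      case True
      then show ?thesis by (simp add: fat_degree_def)
    next
      case False
      then obtain P where P: "P \<in># Z" by auto
      obtain L :: "'k poly3" where L: "linear_form L" "P \<in> zero_locus L"
        by (rule line_through_point)
      define W where "W = residual Z (zero_locus L)"
      define e where "e = size {#X \<in># Z. X \<in> zero_locus L#}"
      have "W \<subseteq># Z" by (simp add: W_def residual_def)
      moreover have "count W P < count Z P" using P L(2) by (simp add: W_def count_residual)
      ultimately have "size W < size Z"
        by (metis mset_subset_size nat_neq_iff subset_mset.nless_le)
      then have "\<forall>\<^sub>F t in sequentially. fat_degree W \<le> hilbert_function (fat_ideal W) t"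
        by (rule less)
      then have "\<forall>\<^sub>F t in sequentially. fat_degree W \<le> hilbert_function (fat_ideal W) t \<and> e \<le> t"
        by (intro eventually_conj eventually_ge_at_top)
      then have "\<forall>\<^sub>F t in sequentially. fat_degree Z \<le> hilbert_function (fat_ideal Z) (Suc t)"
      proof eventually_elim
        case (elim t)
        then show ?case
          using hilbert_function_mod_line_ge[OF L(1), of "Suc t" Z] fat_degree_residual[of Z "zero_locus L"]
          by (simp add: hilbert_function_fat_ideal_Suc[OF L(1)] flip: W_def e_def)
      qed
      then show ?thesis
        using eventually_sequentially_Suc[of "\<lambda>t. fat_degree Z \<le> hilbert_function (fat_ideal Z) t"] by simp
    qed
  qed
  then show ?thesis
    by eventually_elim (use hilbert_function_le_fat_degree in \<open>auto intro: antisym\<close>)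
qed

text \<open>The Hilbert function of the section is the difference of those of \<open>Z\<close> and of its residual, which
  are eventually equal to the degrees.\<close>

lemma scheme_degree_line_section:
  fixes L :: "'k::field_char_0 poly3"
  assumes L: "linear_form L"
  shows "scheme_degree (ideal_sum (fat_ideal Z) (ideal_gen {L})) = size {#X \<in># Z. X \<in> zero_locus L#}"
proof -
  let ?H = "hilbert_function (ideal_sum (fat_ideal Z) (ideal_gen {L}))"
  let ?W = "residual Z (zero_locus L)"
  let ?e = "size {#X \<in># Z. X \<in> zero_locus L#}"
  have "\<forall>\<^sub>F t in sequentially. hilbert_function (fat_ideal Z) (Suc t) = fat_degree Z"
    using hilbert_function_fat_ideal_eventually[of Z]
      eventually_sequentially_Suc[of "\<lambda>t. hilbert_function (fat_ideal Z) t = fat_degree Z"] by simp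
  then have "\<forall>\<^sub>F t in sequentially. ?H (Suc t) = ?e"
    using hilbert_function_fat_ideal_eventually[of ?W]
    by eventually_elim
      (use hilbert_function_fat_ideal_Suc[OF L, of Z] fat_degree_residual[of Z "zero_locus L"] in simp)
  then have e: "\<forall>\<^sub>F t in sequentially. ?H t = ?e"
    using eventually_sequentially_Suc[of "\<lambda>t. ?H t = ?e"] by simp
  moreover have "d = ?e" if "\<forall>\<^sub>F t in sequentially. ?H t = d" for d
    using eventually_happens'[OF sequentially_bot eventually_conj[OF e that]] by auto
  ultimately show ?thesis unfolding scheme_degree_def by (rule the_equality)
qed

section \<open>The Hilbert function from the line degrees\<close>

text \<open>The restriction to the first line contributes \<open>min (t + 1) (e 0)\<close>. If \<open>e 0 > t\<close> both bounds
  for the restriction agree. If \<open>e 0 \<le> t\<close>, then every later minimum is \<open>e b\<close> too,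
  because the degrees drop at least as fast as the other argument, so the sum of all contributions is the degree of the scheme,
  which bounds the Hilbert function from above.\<close>

lemma hilbert_function_strictly_decreasing:
  fixes L :: "nat \<Rightarrow> 'k::field_char_0 poly3"
  assumes "\<And>a. a < n \<Longrightarrow> linear_form (L a)"
    and "\<And>a. a < n \<Longrightarrow> W (Suc a) = residual (W a) (zero_locus (L a))"
    and "\<And>a. a < n \<Longrightarrow> e a = size {#X \<in># W a. X \<in> zero_locus (L a)#}"
    and "\<And>a b. a < b \<Longrightarrow> b < n \<Longrightarrow> e b < e a"
    and "W n = {#}"
  shows "hilbert_function (fat_ideal (W 0)) t = (\<Sum>b<n. min (e b) (t + 1 - b))"
  using assms
proof (induction n arbitrary: W L e t)
  case 0
  have "hilbert_function (fat_ideal (W 0)) t \<le> 0"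
    using hilbert_function_le_fat_degree[of "W 0" t] 0 by (simp add: fat_degree_def)
  then show ?case by simp
next
  case (Suc n)
  note prems = Suc.prems
  let ?S = "ideal_sum (fat_ideal (W 0)) (ideal_gen {L 0})"
  have L0: "linear_form (L 0)" and W1: "W (Suc 0) = residual (W 0) (zero_locus (L 0))"
    and e0: "e 0 = size {#X \<in># W 0. X \<in> zero_locus (L 0)#}"
    using prems(1-3)[of 0] by simp_all
  have IH: "hilbert_function (fat_ideal (W (Suc 0))) s = (\<Sum>b<n. min (e (Suc b)) (s + 1 - b))" for s
  proof (rule Suc.IH[of "\<lambda>a. L (Suc a)" "\<lambda>a. W (Suc a)" "\<lambda>a. e (Suc a)"])
    show "e (Suc b) < e (Suc a)" if "a < b" "b < n" for a b
      using prems(4)[of "Suc a" "Suc b"] that by simp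
  qed (use prems(1-3,5) in auto)
  have lower: "min (t + 1) (e 0) \<le> hilbert_function ?S t"
    unfolding e0 by (rule hilbert_function_mod_line_ge[OF L0])
  have upper: "hilbert_function ?S t \<le> t + 1"
    using homogeneous_fat_ideal by (intro hilbert_function_mod_line_le[OF L0]) (auto simp: homogeneous_def)
  have split: "hilbert_function (fat_ideal (W 0)) t =
      (\<Sum>b<n. min (e (Suc b)) (t - b)) + hilbert_function ?S t"
  proof (cases t)
    case 0
    then show ?thesis
      using hilbert_function_0[OF homogeneous_fat_ideal, of "L 0" "W 0"] L0 by (simp add: linear_form_def)
  next
    case (Suc s)
    then show ?thesis
      using hilbert_function_fat_ideal_Suc[OF L0, of "W 0" s] IH[of s] W1 by simp
  qed
  have "hilbert_function ?S t = min (t + 1) (e 0)"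
  proof (cases "t + 1 \<le> e 0")
    case True
    with lower upper show ?thesis by simp
  next
    case False
    \<comment> \<open>the degrees drop by at least one from line to line, hence are at most \<open>t - b\<close>\<close>
    have decr: "e b + b \<le> t" if "b < Suc n" for b
      using that
    proof (induction b)
      case (Suc b)
      then show ?case using prems(4)[of b "Suc b"] by simp
    qed (use False in simp)
    have "hilbert_function (fat_ideal (W 0)) t \<le> fat_degree (W 0)"
      by (rule hilbert_function_le_fat_degree)
    also have "fat_degree (W 0) = (\<Sum>b<m. e b) + fat_degree (W m)" if "m \<le> Suc n" for m
      using that
    proof (induction m)
      case (Suc m)
      then show ?case
        using fat_degree_residual[of "W m" "zero_locus (L m)"] prems(2,3)[of m] by simp
    qed simp
    from this[of "Suc n"] have "fat_degree (W 0) = (\<Sum>b<Suc n. e b)"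
      using prems(5) by (simp add: fat_degree_def)
    also have "\<dots> = e 0 + (\<Sum>b<n. e (Suc b))" by (rule sum.lessThan_Suc_shift)
    also have "(\<Sum>b<n. e (Suc b)) = (\<Sum>b<n. min (e (Suc b)) (t - b))"
    proof (intro sum.cong refl)
      fix b assume "b \<in> {..<n}"
      then show "e (Suc b) = min (e (Suc b)) (t - b)" using decr[of "Suc b"] by simp
    qed
    finally show ?thesis using lower False by (simp add: split)
  qed
  then show ?case
    by (subst sum.lessThan_Suc_shift) (simp add: split min.commute add.commute)
qed

section \<open>Trading three simple points for a double point\<close>

primrec iterated_residual :: "'p multiset \<Rightarrow> (nat \<Rightarrow> 'p set) \<Rightarrow> nat \<Rightarrow> 'p multiset" where
  "iterated_residual Z l 0 = Z"
| "iterated_residual Z l (Suc a) = residual (iterated_residual Z l a) (l (Suc a))"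

lemma count_iterated_residual:
  "count (iterated_residual Z l m) X = count Z X - card {b \<in> {1..m}. X \<in> l b}"
proof (induction m)
  case (Suc m)
  have "{b \<in> {1..Suc m}. X \<in> l b} =
      (if X \<in> l (Suc m) then insert (Suc m) {b \<in> {1..m}. X \<in> l b} else {b \<in> {1..m}. X \<in> l b})"
    by (auto simp: le_Suc_eq)
  then have "card {b \<in> {1..Suc m}. X \<in> l b} = card {b \<in> {1..m}. X \<in> l b} + (if X \<in> l (Suc m) then 1 else 0)"
    by simp
  then show ?case using Suc by (simp add: count_residual)
qed simp

lemma iterated_residual_eq_empty:
  assumes "\<And>X. count Z X \<le> card {b \<in> {1..n}. X \<in> l b}"
  shows "iterated_residual Z l n = {#}"
  using assms by (intro multiset_eqI) (simp add: count_iterated_residual)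

text \<open>The two simple points on line \<open>i\<close> are replaced by multiplicity two at \<open>X\<close>. One unit of it is
  used up by line \<open>i\<close>, and when line \<open>j\<close> is reached the other one replaces \<open>R\<close>. The remaining
  lines do not meet any of the four points.\<close>

lemma line_degrees_trade:
  fixes l :: "nat \<Rightarrow> 'p set"
  assumes ij: "1 \<le> i" "i < j" "j \<le> n"
    and X: "\<And>b. b \<in> {1..n} \<Longrightarrow> X \<in> l b \<longleftrightarrow> b = i \<or> b = j"
    and Q1: "\<And>b. b \<in> {1..n} \<Longrightarrow> Q1 \<in> l b \<longleftrightarrow> b = i"
    and Q2: "\<And>b. b \<in> {1..n} \<Longrightarrow> Q2 \<in> l b \<longleftrightarrow> b = i"
    and R: "\<And>b. b \<in> {1..n} \<Longrightarrow> R \<in> l b \<longleftrightarrow> b = j"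
    and counts: "count Z Q1 = 1" "count Z Q2 = 1" "count Z R = 1" "count Z X = 0" "Q1 \<noteq> Q2"
    and Z': "Z' = Z - {#R, Q1, Q2#} + replicate_mset 2 X"
    and a: "a < n"
  shows "size {#Y \<in># iterated_residual Z l a. Y \<in> l (Suc a)#} =
    size {#Y \<in># iterated_residual Z' l a. Y \<in> l (Suc a)#}"
proof -
  let ?k = "\<lambda>Y. card {b \<in> {1..a}. Y \<in> l b}"
  define f where "f Z Y = (if Y \<in> l (Suc a) then count Z Y - ?k Y else 0)" for Z Y
  define T where "T = {R, Q1, Q2, X}"
  define S where "S = set_mset Z \<union> set_mset Z' \<union> T"
  have size: "size {#Y \<in># iterated_residual W l a. Y \<in> l (Suc a)#} = (\<Sum>Y\<in>S. f W Y)"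
    if "set_mset W \<subseteq> S" for W
  proof -
    have "set_mset (iterated_residual W l a) \<subseteq> set_mset W"
      by (auto simp: count_iterated_residual simp flip: count_greater_zero_iff)
    then have "set_mset (iterated_residual W l a) \<subseteq> S" using that by blast
    then show ?thesis
      by (subst size_filter_superset[of S]) (auto simp: S_def T_def f_def count_iterated_residual intro!: sum.cong)
  qed
  have distinct: "R \<noteq> Q1" "R \<noteq> Q2" "X \<noteq> R" "X \<noteq> Q1" "X \<noteq> Q2"
    using R[of j] Q1[of j] Q2[of j] ij counts by auto
  have other: "count Z' Y = count Z Y" if "Y \<notin> T" for Y
    using that by (auto simp: Z' T_def)
  have counts': "count Z' R = 0" "count Z' Q1 = 0" "count Z' Q2 = 0" "count Z' X = 2"
    using counts distinct by (auto simp: Z')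
  have lines: "{b \<in> {1..a}. R \<in> l b} = (if j \<le> a then {j} else {})"
    "{b \<in> {1..a}. Q1 \<in> l b} = (if i \<le> a then {i} else {})"
    "{b \<in> {1..a}. Q2 \<in> l b} = (if i \<le> a then {i} else {})"
    "{b \<in> {1..a}. X \<in> l b} = (if j \<le> a then {i, j} else if i \<le> a then {i} else {})"
    using a ij by (auto simp: X Q1 Q2 R)
  have next_line: "R \<in> l (Suc a) \<longleftrightarrow> Suc a = j" "Q1 \<in> l (Suc a) \<longleftrightarrow> Suc a = i"
    "Q2 \<in> l (Suc a) \<longleftrightarrow> Suc a = i" "X \<in> l (Suc a) \<longleftrightarrow> Suc a = i \<or> Suc a = j"
    using a by (simp_all add: X Q1 Q2 R)
  have f_values: "f W R = (if Suc a = j then count W R else 0)"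
    "f W Q1 = (if Suc a = i then count W Q1 else 0)"
    "f W Q2 = (if Suc a = i then count W Q2 else 0)"
    "f W X = (if Suc a = i then count W X else if Suc a = j then count W X - 1 else 0)" for W
    unfolding f_def lines next_line using ij by auto
  have "(\<Sum>Y\<in>T. f Z Y) = (\<Sum>Y\<in>T. f Z' Y)"
  proof -
    have sum_T: "(\<Sum>Y\<in>T. g Y) = g R + (g Q1 + (g Q2 + g X))" for g :: "'p \<Rightarrow> nat"
      using distinct counts(5) by (auto simp: T_def)
    show ?thesis
      using \<open>i < j\<close> by (auto simp: sum_T f_values counts counts')
  qed
  moreover have "(\<Sum>Y\<in>S - T. f Z Y) = (\<Sum>Y\<in>S - T. f Z' Y)"
    by (intro sum.cong) (auto simp: f_def other)
  moreover have "(\<Sum>Y\<in>S. f W Y) = (\<Sum>Y\<in>S - T. f W Y) + (\<Sum>Y\<in>T. f W Y)" for W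
    by (rule sum.subset_diff) (auto simp: S_def T_def)
  ultimately have "(\<Sum>Y\<in>S. f Z Y) = (\<Sum>Y\<in>S. f Z' Y)" by simp
  moreover have "set_mset Z \<subseteq> S" "set_mset Z' \<subseteq> S" by (auto simp: S_def)
  ultimately show ?thesis by (simp add: size)
qed

theorem theorem3p1:
  fixes n :: nat
    and L :: "nat \<Rightarrow> 'k::{alg_closed_field, field_char_0} poly3"
    and l :: "nat \<Rightarrow> 'k proj_plane set"
    and P :: "nat \<Rightarrow> nat \<Rightarrow> 'k proj_plane"
    and Z Z' :: "'k proj_plane multiset"
    and I :: "nat \<Rightarrow> 'k poly3 set"
    and d :: "nat \<Rightarrow> nat"
    and i j :: nat
    and Q1 Q2 R :: "'k proj_plane"
  assumes line_forms: "\<And>a. a \<in> {1..n} \<Longrightarrow> linear_form (L a)"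
    and lines: "\<And>a. a \<in> {1..n} \<Longrightarrow> l a = zero_locus (L a)"
    and lines_distinct: "inj_on l {1..n}"
    and no_three_concurrent:
      "\<And>a b c. 1 \<le> a \<Longrightarrow> a < b \<Longrightarrow> b < c \<Longrightarrow> c \<le> n \<Longrightarrow> l a \<inter> l b \<inter> l c = {}"
    and intersection_points: "\<And>a b. 1 \<le> a \<Longrightarrow> a < b \<Longrightarrow> b \<le> n \<Longrightarrow> l a \<inter> l b = {P a b}"
    and double_or_reduced: "\<And>X. X \<in> set_mset Z \<Longrightarrow> double_point Z X \<or> reduced_point Z X"
    and cond_a: "set_mset Z \<subseteq> (\<Union>a\<in>{1..n}. l a)"
    and cond_b: "\<And>X. double_point Z X \<Longrightarrow> \<exists>a b. 1 \<le> a \<and> a < b \<and> b \<le> n \<and> X = P a b"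
    and cond_c: "\<And>Q a p. reduced_point Z Q \<Longrightarrow> a \<in> {1..n} \<Longrightarrow> Q \<in> l a \<Longrightarrow>
                   p \<in> {1..n} \<Longrightarrow> p \<noteq> a \<Longrightarrow> l a \<inter> l p \<noteq> {Q}"
    and cond_d_start: "I 0 = fat_ideal Z"
    and cond_d_residual: "\<And>a. a \<in> {1..n} \<Longrightarrow> I a = ideal_colon (I (a - 1)) (ideal_gen {L a})"
    and cond_d_degree:
      "\<And>a. a \<in> {1..n} \<Longrightarrow> d a = scheme_degree (ideal_sum (I (a - 1)) (ideal_gen {L a}))"
    and cond_d_decreasing: "\<And>a b. 1 \<le> a \<Longrightarrow> a < b \<Longrightarrow> b \<le> n \<Longrightarrow> d a > d b"
    and cond_e_indices: "1 \<le> i" "i < j" "j \<le> n"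
    and cond_e_Q: "reduced_point Z Q1" "reduced_point Z Q2" "Q1 \<noteq> Q2" "Q1 \<in> l i" "Q2 \<in> l i"
    and cond_e_R: "reduced_point Z R" "R \<in> l j"
    and cond_e_not_double: "\<not> double_point Z (P i j)"
    and Z'_def: "Z' = (Z - {#R, Q1, Q2#}) + replicate_mset 2 (P i j)"
  shows "hilbert_function (fat_ideal Z) = hilbert_function (fat_ideal Z')"
proof -
  have i: "i \<in> {1..n}" and j: "j \<in> {1..n}" and "i \<noteq> j" using cond_e_indices by auto
  have meet: "\<exists>X. l a \<inter> l b = {X}" if "a \<in> {1..n}" "b \<in> {1..n}" "a \<noteq> b" for a b
    using that intersection_points[of a b] intersection_points[of b a]
    by (cases a b rule: linorder_cases) (auto simp: Int_commute)
  have simple_line: "Q \<in> l b \<longleftrightarrow> b = a"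
    if "reduced_point Z Q" "a \<in> {1..n}" "Q \<in> l a" "b \<in> {1..n}" for Q a b
  proof -
    have "b = a" if "Q \<in> l b"
    proof (rule ccontr)
      assume "b \<noteq> a"
      then obtain X where "l a \<inter> l b = {X}"
        using meet \<open>a \<in> {1..n}\<close> \<open>b \<in> {1..n}\<close> by metis
      moreover have "Q \<in> l a \<inter> l b" using that \<open>Q \<in> l a\<close> by simp
      ultimately have "l a \<inter> l b = {Q}" by simp
      then show False
        using cond_c[OF \<open>reduced_point Z Q\<close> \<open>a \<in> {1..n}\<close> \<open>Q \<in> l a\<close> \<open>b \<in> {1..n}\<close> \<open>b \<noteq> a\<close>] by simp
    qed
    then show ?thesis using \<open>Q \<in> l a\<close> by blast
  qed
  define X where "X = P i j"
  have X_on: "X \<in> l i" "X \<in> l j"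
    using intersection_points[of i j] cond_e_indices by (auto simp: X_def)
  have X_lines: "X \<in> l b \<longleftrightarrow> b = i \<or> b = j" if b: "b \<in> {1..n}" for b
  proof -
    have "b = i \<or> b = j" if "X \<in> l b"
    proof (rule ccontr)
      assume "\<not> (b = i \<or> b = j)"
      then consider "b < i" | "i < b" "b < j" | "j < b" by linarith
      then show False
      proof cases
        case 1
        then show False using no_three_concurrent[of b i j] cond_e_indices b that X_on by auto
      next
        case 2
        then show False using no_three_concurrent[of i b j] cond_e_indices that X_on by auto
      next
        case 3
        then show False using no_three_concurrent[of i j b] cond_e_indices b that X_on by auto
      qed
    qed
    then show ?thesis using X_on by blast
  qed
  \<comment> \<open>a simple point lies on one line only, and \<open>X\<close> is not double, so it does not occur in \<open>Z\<close> at all\<close>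
  have "\<not> reduced_point Z X"
    using simple_line[of X i j] X_on i j \<open>i \<noteq> j\<close> by auto
  then have "X \<notin># Z"
    using double_or_reduced[of X] cond_e_not_double by (auto simp: X_def)
  then have count_X: "count Z X = 0" by (simp add: not_in_iff)
  have counts: "count Z Q1 = 1" "count Z Q2 = 1" "count Z R = 1"
    using cond_e_Q cond_e_R by (simp_all add: reduced_point_def)
  define e where "e a = size {#Y \<in># iterated_residual Z l a. Y \<in> l (Suc a)#}" for a
  have e': "e a = size {#Y \<in># iterated_residual Z' l a. Y \<in> l (Suc a)#}" if "a < n" for a
    unfolding e_def
  proof (rule line_degrees_trade[OF cond_e_indices X_lines])
    fix b assume b: "b \<in> {1..n}"
    show "Q1 \<in> l b \<longleftrightarrow> b = i" "Q2 \<in> l b \<longleftrightarrow> b = i" "R \<in> l b \<longleftrightarrow> b = j"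
      using simple_line b i j cond_e_Q cond_e_R by blast+
  qed (use Z'_def X_def counts count_X cond_e_Q that in simp_all)
  \<comment> \<open>every point lies on at least as many lines as its multiplicity, so nothing is left at the end\<close>
  have on_lines: "count Z Y \<le> card {b \<in> {1..n}. Y \<in> l b}" for Y
  proof (cases "Y \<in># Z")
    case True
    then consider "double_point Z Y" | "reduced_point Z Y" using double_or_reduced by blast
    then show ?thesis
    proof cases
      case 1
      then obtain a b where ab: "1 \<le> a" "a < b" "b \<le> n" "Y = P a b" using cond_b by blast
      then have "{a, b} \<subseteq> {b \<in> {1..n}. Y \<in> l b}" using intersection_points[of a b] by auto
      then have "card {a, b} \<le> card {b \<in> {1..n}. Y \<in> l b}" by (intro card_mono) auto
      then show ?thesis using 1 ab by (simp add: double_point_def)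
    next
      case 2
      obtain a where "a \<in> {1..n}" "Y \<in> l a" using cond_a True by blast
      then have "card {a} \<le> card {b \<in> {1..n}. Y \<in> l b}" by (intro card_mono) auto
      then show ?thesis using 2 by (simp add: reduced_point_def)
    qed
  qed (simp add: not_in_iff)
  have on_lines': "count Z' Y \<le> card {b \<in> {1..n}. Y \<in> l b}" for Y
  proof (cases "Y = X")
    case True
    have "{b \<in> {1..n}. X \<in> l b} = {i, j}" using X_lines i j by auto
    then show ?thesis using True count_X \<open>i \<noteq> j\<close> by (simp add: Z'_def X_def)
  next
    case False
    then have "count Z' Y \<le> count Z Y" by (simp add: Z'_def X_def)
    then show ?thesis using on_lines[of Y] by simp
  qed
  have I: "I a = fat_ideal (iterated_residual Z l a)" if "a \<le> n" for a
    using that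
  proof (induction a)
    case (Suc a)
    then show ?case
      using cond_d_residual[of "Suc a"] lines[of "Suc a"]
        ideal_colon_fat_ideal[OF line_forms[of "Suc a"], of "iterated_residual Z l a"] by simp
  qed (simp add: cond_d_start)
  have d: "d (Suc a) = e a" if "a < n" for a
    using that cond_d_degree[of "Suc a"] I[of a] line_forms[of "Suc a"] lines[of "Suc a"]
    by (simp add: scheme_degree_line_section e_def)
  have formula: "hilbert_function (fat_ideal (iterated_residual W l 0)) t = (\<Sum>b<n. min (e b) (t + 1 - b))"
    if "\<And>a. a < n \<Longrightarrow> e a = size {#Y \<in># iterated_residual W l a. Y \<in> l (Suc a)#}"
      and "\<And>Y. count W Y \<le> card {b \<in> {1..n}. Y \<in> l b}" for W t
  proof (rule hilbert_function_strictly_decreasing[of n "\<lambda>a. L (Suc a)"])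
    show "e b < e a" if "a < b" "b < n" for a b
      using cond_d_decreasing[of "Suc a" "Suc b"] d[of a] d[of b] that by simp
    show "iterated_residual W l n = {#}"
      by (rule iterated_residual_eq_empty) (rule that(2))
  qed (use that(1) line_forms lines in simp_all)
  show ?thesis
    using formula[OF e_def on_lines] formula[OF e' on_lines'] by (auto simp: fun_eq_iff)
qed

end
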